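(* Let $0\le\delta<\rho\le1$, $\mu\in\mathbb{R}$ and $\sigma\in S^\mu_{\rho,\delta}(\mathbb{Z}^n\times\mathbb{T}^n)$. Then there exists a symbol $\sigma^*\in S^\mu_{\rho,\delta}(\mathbb{Z}^n\times\mathbb{T}^n)$ such that the adjoint operator $\mathrm{Op}(\sigma)^*$ is the pseudo-difference operator with symbol $\sigma^*$, i.e. $\mathrm{Op}(\sigma)^*=\mathrm{Op}(\sigma^* )$, and $$\sigma^*(k,x)\sim\sum_\alpha\frac{1}{\alpha!}\,\Delta_k^\alpha D_x^{(\alpha)}\overline{\sigma(k,x)},$$ which means that for every $N\in\mathbb{N}$ $$\sigma^*-\sum_{|\alpha|<N}\frac{1}{\alpha!}\,\Delta_k^\alpha D_x^{(\alpha)}\overline{\sigma}\in S^{\mu-N(\rho-\delta)}_{\rho,\delta}(\mathbb{Z}^n\times\mathbb{T}^n).$$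
   Context: $\mathbb{T}^n=\mathbb{R}^n/\mathbb{Z}^n$ with normalised Lebesgue measure; $k\cdot x=\sum_j k_jx_j$; $\mathcal{S}(\mathbb{Z}^n)$ is the space of rapidly decreasing functions $f:\mathbb{Z}^n\to\mathbb{C}$ (for every $M$, $|f(k)|\le C_M(1+|k|)^{-M}$). The Fourier transform is $\widehat f(x)=\sum_{k\in\mathbb{Z}^n}e^{-2\pi i k\cdot x}f(k)$, $x\in\mathbb{T}^n$. For $\sigma:\mathbb{Z}^n\times\mathbb{T}^n\to\mathbb{C}$ the pseudo-difference operator with symbol $\sigma$ is $\mathrm{Op}(\sigma)f(k)=\int_{\mathbb{T}^n}e^{2\pi i k\cdot x}\sigma(k,x)\widehat f(x)\,dx$, $k\in\mathbb{Z}^n$. The adjoint $T^*$ of an operator $T$ is defined by $(Tf,g)_{\ell^2(\mathbb{Z}^n)}=(f,T^*g)_{\ell^2(\mathbb{Z}^n)}$ for $f,g\in\mathcal{S}(\mathbb{Z}^n)$, where $(f,g)_{\ell^2(\mathbb{Z}^n)}=\sum_k f(k)\overline{g(k)}$. Difference operators: $\Delta^\alpha=\Delta_1^{\alpha_1}\cdots\Delta_n^{\alpha_n}$, $\Delta_j\tau(k)=\tau(k+v_j)-\tau(k)$, $v_j$ the $j$-th standard unit vector; $\Delta_k^\alpha$ indicates action in the variable $k$. Derivatives: $D_x^{(\alpha)}=D_{x_1}^{(\alpha_1)}\cdots D_{x_n}^{(\alpha_n)}$, where $D_{x_j}^{(0)}=I$ and $D_{x_j}^{(\ell)}=\prod_{m=0}^{\ell-1}\big(\frac{1}{2\pi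 i}\frac{\partial}{\partial x_j}-m\big)$ for $\ell\ge1$. Symbol classes: for $\mu,\rho,\delta\in\mathbb{R}$, $S^\mu_{\rho,\delta}(\mathbb{Z}^n\times\mathbb{T}^n)$ is the set of $\sigma:\mathbb{Z}^n\times\mathbb{T}^n\to\mathbb{C}$ such that $\sigma(k,\cdot)\in C^\infty(\mathbb{T}^n)$ for all $k$ and for all multi-indices $\alpha,\beta$ there is $C_{\alpha,\beta}>0$ with $|D_x^{(\beta)}\Delta_k^\alpha\sigma(k,x)|\le C_{\alpha,\beta}(1+|k|)^{\mu-\rho|\alpha|+\delta|\beta|}$ for all $(k,x)\in\mathbb{Z}^n\times\mathbb{T}^n$. *)

theory Defs
  imports "HOL-Analysis.Analysis"
begin

text \<open>
  The lattice \<open>\<int>\<^sup>n\<close> is the type \<^typ>\<open>int ^ 'n\<close>. Functions on the torus \<open>\<real>\<^sup>n/\<int>\<^sup>n\<close> are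
  \<open>\<int>\<^sup>n\<close>-periodic functions on \<^typ>\<open>real ^ 'n\<close>, and integration against the normalised Lebesgue
  measure of the torus is integration over the unit cube \<open>cbox 0 1\<close>. The linear order on the
  index type only serves to write the operators of a multi-index in the order of the coordinates.
\<close>

definition of_lattice :: "int ^ 'n \<Rightarrow> real ^ 'n" where
  "of_lattice k = (\<chi> j. real_of_int (k $ j))"

abbreviation lattice_norm :: "int ^ 'n::finite \<Rightarrow> real" where
  "lattice_norm k \<equiv> norm (of_lattice k)"

definition character :: "int ^ 'n::finite \<Rightarrow> real ^ 'n \<Rightarrow> complex" where
  "character k x = exp (2 * of_real pi * \<i> * of_real (of_lattice k \<bullet> x))"


subsection \<open>Multi-indices\<close>

definition mi_size :: "nat ^ 'n::finite \<Rightarrow> nat" where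
  "mi_size \<alpha> = (\<Sum>j\<in>UNIV. \<alpha> $ j)"

definition mi_fact :: "nat ^ 'n::finite \<Rightarrow> nat" where
  "mi_fact \<alpha> = (\<Prod>j\<in>UNIV. fact (\<alpha> $ j))"

lemma finite_mi_size_less: "finite {\<alpha> :: nat ^ 'n::finite. mi_size \<alpha> < N}"
proof (rule finite_subset)
  show "{\<alpha> :: nat ^ 'n. mi_size \<alpha> < N} \<subseteq> vec_lambda ` {f. \<forall>j. f j \<in> {..<N}}"
  proof
    fix \<alpha> :: "nat ^ 'n"
    assume "\<alpha> \<in> {\<alpha>. mi_size \<alpha> < N}"
    moreover have "\<alpha> $ j \<le> mi_size \<alpha>" for j
      unfolding mi_size_def by (rule member_le_sum) auto
    ultimately have "\<forall>j. \<alpha> $ j \<in> {..<N}"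
      by (auto intro: le_less_trans)
    then show "\<alpha> \<in> vec_lambda ` {f. \<forall>j. f j \<in> {..<N}}"
      by (intro image_eqI[of _ _ "vec_nth \<alpha>"]) auto
  qed
  have "finite {f :: 'n \<Rightarrow> nat. \<forall>j. f j \<in> {..<N}}"
    using finite_PiE[of "UNIV :: 'n set" "\<lambda>_. {..<N}"] by (simp add: PiE_def Pi_def)
  then show "finite (vec_lambda ` {f :: 'n \<Rightarrow> nat. \<forall>j. f j \<in> {..<N}})"
    by (rule finite_imageI)
qed


subsection \<open>Difference operators and derivatives\<close>

definition diff_op :: "'n::finite \<Rightarrow> (int ^ 'n \<Rightarrow> complex) \<Rightarrow> int ^ 'n \<Rightarrow> complex" where
  "diff_op j \<tau> k = \<tau> (k + axis j 1) - \<tau> k"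

definition mi_diff_op ::
  "nat ^ 'n::{finite,linorder} \<Rightarrow>
   (int ^ 'n::{finite,linorder} \<Rightarrow> complex) \<Rightarrow> int ^ 'n::{finite,linorder} \<Rightarrow> complex" where
  "mi_diff_op \<alpha> \<tau> = foldr (\<lambda>j. diff_op j ^^ (\<alpha> $ j)) (sorted_list_of_set UNIV) \<tau>"

definition partial_deriv :: "'n::finite \<Rightarrow> (real ^ 'n \<Rightarrow> complex) \<Rightarrow> real ^ 'n \<Rightarrow> complex" where
  "partial_deriv j f x = vector_derivative (\<lambda>t. f (x + t *\<^sub>R axis j 1)) (at 0)"

text \<open>The falling factorials \<open>D\<^sub>j (D\<^sub>j - 1) \<dots> (D\<^sub>j - (l - 1))\<close> of \<open>D\<^sub>j = (1 / 2\<pi>i) \<partial>\<^sub>j\<close>.\<close>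

primrec fall_deriv ::
  "'n::finite \<Rightarrow> nat \<Rightarrow> (real ^ 'n \<Rightarrow> complex) \<Rightarrow> real ^ 'n \<Rightarrow> complex" where
  "fall_deriv j 0 f = f"
| "fall_deriv j (Suc l) f =
     (\<lambda>x. 1 / (2 * of_real pi * \<i>) * partial_deriv j (fall_deriv j l f) x
          - of_nat l * fall_deriv j l f x)"

definition mi_fall_deriv ::
  "nat ^ 'n::{finite,linorder} \<Rightarrow>
   (real ^ 'n::{finite,linorder} \<Rightarrow> complex) \<Rightarrow> real ^ 'n::{finite,linorder} \<Rightarrow> complex" where
  "mi_fall_deriv \<beta> f = foldr (\<lambda>j. fall_deriv j (\<beta> $ j)) (sorted_list_of_set UNIV) f"


subsection \<open>Smooth functions on the torus\<close>

primrec cont_diff :: "nat \<Rightarrow> (real ^ 'n::finite \<Rightarrow> complex) \<Rightarrow> bool" where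
  "cont_diff 0 f \<longleftrightarrow> continuous_on UNIV f"
| "cont_diff (Suc m) f \<longleftrightarrow>
     (\<forall>j. (\<forall>x. (\<lambda>t. f (x + t *\<^sub>R axis j 1)) differentiable (at 0)) \<and>
          cont_diff m (partial_deriv j f))"

definition smooth_on_torus :: "(real ^ 'n::finite \<Rightarrow> complex) \<Rightarrow> bool" where
  "smooth_on_torus f \<longleftrightarrow>
     (\<forall>m x. f (x + of_lattice m) = f x) \<and> (\<forall>r. cont_diff r f)"


subsection \<open>Symbols and pseudo-difference operators\<close>

definition symbol_class ::
  "real \<Rightarrow> real \<Rightarrow> real \<Rightarrow>
   (int ^ 'n::{finite,linorder} \<Rightarrow> real ^ 'n::{finite,linorder} \<Rightarrow> complex) set" where
  "symbol_class \<mu> \<rho> \<delta> =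
     {\<sigma>. (\<forall>k. smooth_on_torus (\<sigma> k)) \<and>
         (\<forall>\<alpha> \<beta>. \<exists>C>0. \<forall>k x.
            cmod (mi_fall_deriv \<beta> (\<lambda>y. mi_diff_op \<alpha> (\<lambda>l. \<sigma> l y) k) x)
              \<le> C * (1 + lattice_norm k)
                    powr (\<mu> - \<rho> * real (mi_size \<alpha>) + \<delta> * real (mi_size \<beta>)))}"

definition rapidly_decreasing :: "(int ^ 'n::finite \<Rightarrow> complex) set" where
  "rapidly_decreasing =
     {f. \<forall>M::real. \<exists>C. \<forall>k. cmod (f k) \<le> C * (1 + lattice_norm k) powr (- M)}"

definition fourier :: "(int ^ 'n::finite \<Rightarrow> complex) \<Rightarrow> real ^ 'n \<Rightarrow> complex" where
  "fourier f x = (\<Sum>\<^sub>\<infinity>k. character (- k) x * f k)"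

definition Op ::
  "(int ^ 'n::finite \<Rightarrow> real ^ 'n \<Rightarrow> complex) \<Rightarrow> (int ^ 'n \<Rightarrow> complex) \<Rightarrow> int ^ 'n \<Rightarrow> complex" where
  "Op \<sigma> f k = (LINT x:cbox 0 1|lborel. character k x * \<sigma> k x * fourier f x)"


subsection \<open>Adjoints\<close>

definition ell2_inner ::
  "(int ^ 'n::finite \<Rightarrow> complex) \<Rightarrow> (int ^ 'n \<Rightarrow> complex) \<Rightarrow> complex" where
  "ell2_inner f g = (\<Sum>\<^sub>\<infinity>k. f k * cnj (g k))"

text \<open>
  \<open>T'\<close> is the adjoint of \<open>T\<close>, both being considered as operators on \<open>rapidly_decreasing\<close>. Since
  \<^const>\<open>infsum\<close> is \<open>0\<close> on families that are not summable, convergence of the two series is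
  required explicitly.
\<close>

definition is_adjoint ::
  "((int ^ 'n::finite \<Rightarrow> complex) \<Rightarrow> (int ^ 'n \<Rightarrow> complex)) \<Rightarrow>
   ((int ^ 'n \<Rightarrow> complex) \<Rightarrow> (int ^ 'n \<Rightarrow> complex)) \<Rightarrow> bool" where
  "is_adjoint T T' \<longleftrightarrow>
     (\<forall>f\<in>rapidly_decreasing. \<forall>g\<in>rapidly_decreasing.
        (\<lambda>k. T f k * cnj (g k)) summable_on UNIV \<and>
        (\<lambda>k. f k * cnj (T' g k)) summable_on UNIV \<and>
        ell2_inner (T f) g = ell2_inner f (T' g))"

lemma is_adjoint_unique:
  fixes T T1 T2 :: "(int ^ 'n::finite \<Rightarrow> complex) \<Rightarrow> int ^ 'n \<Rightarrow> complex"
  assumes "is_adjoint T T1" "is_adjoint T T2" "g \<in> rapidly_decreasing"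
  shows "T1 g = T2 g"
proof
  fix k :: "int ^ 'n"
  define f :: "int ^ 'n \<Rightarrow> complex" where "f = (\<lambda>l. if l = k then 1 else 0)"
  have "f \<in> rapidly_decreasing"
    unfolding rapidly_decreasing_def
  proof (intro CollectI allI)
    fix M :: real
    have "1 + lattice_norm k > 0"
      by (smt (verit) norm_ge_zero)
    then have "\<forall>l. cmod (f l) \<le> (1 + lattice_norm k) powr M * (1 + lattice_norm l) powr (- M)"
      by (auto simp: f_def powr_minus field_simps)
    then show "\<exists>C. \<forall>l. cmod (f l) \<le> C * (1 + lattice_norm l) powr (- M)"
      by blast
  qed
  then have "ell2_inner f (T1 g) = ell2_inner f (T2 g)"
    using assms unfolding is_adjoint_def by metis
  moreover have "ell2_inner f h = cnj (h k)" for h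
  proof -
    have "ell2_inner f h = (\<Sum>\<^sub>\<infinity>l\<in>{k}. f l * cnj (h l))"
      unfolding ell2_inner_def by (rule infsum_cong_neutral) (auto simp: f_def)
    then show ?thesis
      by (simp add: f_def)
  qed
  ultimately show "T1 g k = T2 g k"
    by simp
qed

end

theory Submission
  imports Defs
begin

text \<open>
  Write \<open>\<sigma>(k, x) = \<Sum>\<^sub>m a(k, m) exp(2 \<pi> i m \<bullet> x)\<close> and let \<open>b(k, m)\<close> be the Fourier coefficients of the
  conjugate of \<open>\<sigma>\<close>. Comparing matrix entries, the adjoint has the symbol with coefficients
  \<open>b(k + m, m)\<close>. Newton's formula
  \<open>b(k + m, m) = \<Sum>\<^sub>\<alpha> binom(m, \<alpha>) \<Delta>\<^sup>\<alpha> b(k, m) + remainder\<close> is the asymptotic expansion, because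
  \<open>\<alpha>! binom(m, \<alpha>)\<close> is the Fourier multiplier of \<open>D\<^bsup>(\<alpha>)\<^esup>\<close>. The passage from \<open>b\<close> to the remainder commutes
  with all differences and derivatives, so it suffices to bound the remainder itself. There
  \<open>\<bar>m\<bar>\<^sup>M \<bar>\<Delta>\<^sup>\<alpha> b(k, m)\<bar> \<le> C (1 + \<bar>k\<bar>)\<^sup>s\<close> with \<open>s = \<mu> - \<rho> \<bar>\<alpha>\<bar> + \<delta> M\<close>; taking a longer expansion, \<open>M\<close>
  slightly larger than its length, and Peetre's inequality for the negative power \<open>s\<close> gives a
  summable bound of arbitrarily low order in \<open>k\<close>, from which the additional terms are removed again.
\<close>

subsection \<open>Rapidly decreasing sequences\<close>

text \<open>Symbol estimates are kept as supremum bounds of series (\<open>coeff_class\<close>),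
  because the return from single coefficients to a supremum is not free: summing over m consumes 2 n
  powers of \<open>weight m\<close>, n being the dimension, and the class supplies each of them at
  the price of \<delta> orders in k. Only the remainder of the long expansion, where orders are
  abundant, is bounded coefficient by coefficient; the surplus terms are removed with the lossless
  supremum bounds. For an expansion of length N' with M powers of decay, the remainder has
  k-exponent \<mu> - \<rho> N' + \<delta> M and m-exponent (1 + \<rho>) N' - (1 + \<delta>) M -
  \<mu>, since the shift from k to k + \<theta>, with \<theta> of the size of m, is paid for by m.
  For \<delta> > 0 both tend to minus infinity when M / N' stays fixed strictly between (1 + \<rho>)
  / (1 + \<delta>) and \<rho> / \<delta>; the condition \<delta> < \<rho> says exactly that this
  window is non-empty.\<close>

lemma of_lattice_simps [simp]:
  "of_lattice (k + l) = of_lattice k + of_lattice l"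
  "of_lattice (k - l) = of_lattice k - of_lattice l"
  "of_lattice (- k) = - of_lattice k"
  "of_lattice 0 = 0"
  by (simp_all add: of_lattice_def vec_eq_iff)

lemma of_lattice_axis [simp]: "of_lattice (axis j 1) = axis j 1"
  by (simp add: of_lattice_def vec_eq_iff axis_def)

abbreviation weight :: "int ^ 'n::finite \<Rightarrow> real" where
  "weight k \<equiv> 1 + lattice_norm k"

lemma weight_ge_1 [simp]: "1 \<le> weight k"
  by simp

lemma weight_pos [simp]: "0 < weight k"
  using weight_ge_1[of k] by linarith

lemma weight_nonzero [simp]: "weight k \<noteq> 0"
  using weight_pos[of k] by linarith

lemma weight_add_le: "weight (k + l) \<le> weight k * weight l"
proof -
  have "weight (k + l) \<le> 1 + lattice_norm k + lattice_norm l"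
    using norm_triangle_ineq[of "of_lattice k" "of_lattice l"] by simp
  also have "\<dots> \<le> weight k * weight l"
    by (simp add: algebra_simps)
  finally show ?thesis .
qed

lemma abs_coord_le_lattice_norm: "real_of_int \<bar>m $ j\<bar> \<le> lattice_norm m"
  using component_le_norm_cart[of "of_lattice m" j] by (simp add: of_lattice_def)

text \<open>The number of unit steps from 0 to m. It is comparable to the norm, and unlike the norm
  it drops by exactly one along a suitable step, which is what \<open>norm_le_lattice_path\<close>
  inducts on.\<close>

definition l1_size :: "int ^ 'n::finite \<Rightarrow> nat" where
  "l1_size m = (\<Sum>j\<in>UNIV. nat \<bar>m $ j\<bar>)"

lemma of_nat_l1_size: "real (l1_size m) = (\<Sum>j\<in>UNIV. real_of_int \<bar>m $ j\<bar>)"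
  by (simp add: l1_size_def)

lemma lattice_norm_le_l1_size: "lattice_norm m \<le> real (l1_size m)"
  using norm_le_l1_cart[of "of_lattice m"] by (simp add: of_nat_l1_size of_lattice_def)

lemma l1_size_le: "real (l1_size (m :: int ^ 'n::finite)) \<le> real CARD('n) * lattice_norm m"
proof -
  have "real (l1_size m) \<le> (\<Sum>j\<in>(UNIV::'n set). lattice_norm m)"
    unfolding of_nat_l1_size by (intro sum_mono abs_coord_le_lattice_norm)
  then show ?thesis by simp
qed

section \<open>Summability of inverse powers of the weight\<close>

lemma inverse_square_sum_int_bounded:
  "\<exists>S. \<forall>R::nat. (\<Sum>i\<in>{-int R..int R}. 1 / (1 + \<bar>real_of_int i\<bar>)^2) \<le> S"
proof -
  define g where "g n = 1 / (1 + real n)^2" for n :: nat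
  have sg: "summable g"
    using summable_Suc_iff[of "\<lambda>n. inverse (real n ^ 2)"] inverse_power_summable[of 2, where 'a=real]
    by (simp add: g_def[abs_def] field_simps)
  have le: "(\<Sum>n\<in>{..R}. g n) \<le> suminf g" for R
    by (rule sum_le_suminf[OF sg]) (auto simp: g_def)
  have "(\<Sum>i\<in>{-int R..int R}. 1 / (1 + \<bar>real_of_int i\<bar>)^2) \<le> 2 * suminf g" for R
  proof -
    have "(\<Sum>i\<in>{-int R..int R}. 1 / (1 + \<bar>real_of_int i\<bar>)^2) \<le>
       (\<Sum>i\<in>int ` {..R} \<union> (\<lambda>n. - int n) ` {..R}. 1 / (1 + \<bar>real_of_int i\<bar>)^2)"
    proof (rule sum_mono2)
      show "{-int R..int R} \<subseteq> int ` {..R} \<union> (\<lambda>n. - int n) ` {..R}"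
      proof
        fix i assume i: "i \<in> {-int R..int R}"
        show "i \<in> int ` {..R} \<union> (\<lambda>n. - int n) ` {..R}"
        proof (cases "i \<ge> 0")
          case True
          then have "i = int (nat i)" "nat i \<in> {..R}" using i by auto
          then show ?thesis by blast
        next
          case False
          then have "i = - int (nat (-i))" "nat (-i) \<in> {..R}" using i by auto
          then show ?thesis by blast
        qed
      qed
    qed auto
    also have "\<dots> \<le> (\<Sum>i\<in>int ` {..R}. 1 / (1 + \<bar>real_of_int i\<bar>)^2) +
        (\<Sum>i\<in>(\<lambda>n. - int n) ` {..R}. 1 / (1 + \<bar>real_of_int i\<bar>)^2)"
      by (simp add: sum_Un sum_nonneg)
    also have "\<dots> = (\<Sum>n\<in>{..R}. g n) + (\<Sum>n\<in>{..R}. g n)"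
      by (simp add: sum.reindex inj_on_def g_def)
    also have "\<dots> \<le> 2 * suminf g" using le[of R] by simp
    finally show ?thesis .
  qed
  then show ?thesis by blast
qed

text \<open>The norm dominates each coordinate, so the summand is at most the product over j of 1 /
  (1 + |m_j|)^2, and over a box the sum of such a product factors into one-dimensional sums. One
  square per coordinate is the origin of the exponent \<open>2 * CARD('n)\<close>.\<close>

lemma summable_on_inverse_weight_power:
  "(\<lambda>m :: int ^ 'n::finite. 1 / weight m ^ (2 * CARD('n))) summable_on UNIV"
proof -
  obtain S where S: "\<And>R::nat. (\<Sum>i\<in>{-int R..int R}. 1 / (1 + \<bar>real_of_int i\<bar>)^2) \<le> S"
    using inverse_square_sum_int_bounded by blast
  define g where "g i = 1 / (1 + \<bar>real_of_int i\<bar>)^2" for i :: int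
  have g0: "0 \<le> g i" for i by (simp add: g_def)
  have le_prod: "1 / weight m ^ (2 * CARD('n)) \<le> (\<Prod>j\<in>UNIV. g (m $ j))" for m :: "int ^ 'n"
  proof -
    have "(\<Prod>j\<in>(UNIV::'n set). 1 / weight m ^ 2) \<le> (\<Prod>j\<in>UNIV. g (m $ j))"
    proof (rule prod_mono, safe)
      fix j
      have "(1 + \<bar>real_of_int (m $ j)\<bar>)^2 \<le> weight m ^ 2"
        using abs_coord_le_lattice_norm[of m j] by (intro power_mono) auto
      then show "1 / weight m ^ 2 \<le> g (m $ j)"
        unfolding g_def by (intro divide_left_mono) (auto intro!: mult_pos_pos zero_less_power)
    qed simp
    then show ?thesis by (simp add: power_mult power_one_over)
  qed
  have bound: "(\<Sum>m\<in>F. 1 / weight m ^ (2 * CARD('n))) \<le> S ^ CARD('n)"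
    if F: "finite F" for F :: "(int ^ 'n) set"
  proof -
    \<comment> \<open>\<open>insert 0\<close> keeps \<open>Max\<close> defined when \<open>F\<close>
      is empty.\<close>
    define R where "R = Max (insert 0 ((\<lambda>m. l1_size m) ` F))"
    have R: "m $ j \<in> {- int R..int R}" if "m \<in> F" for m j
    proof -
      have "nat \<bar>m $ j\<bar> \<le> l1_size m"
        unfolding l1_size_def by (rule member_le_sum) auto
      also have "\<dots> \<le> R" unfolding R_def using F that by (intro Max_ge) auto
      finally show ?thesis by auto
    qed
    have "(\<Sum>m\<in>F. 1 / weight m ^ (2 * CARD('n))) \<le> (\<Sum>m\<in>F. \<Prod>j\<in>UNIV. g (m $ j))"
      by (intro sum_mono le_prod)
    also have "\<dots> = (\<Sum>f\<in>vec_nth ` F. \<Prod>j\<in>UNIV. g (f j))"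
      by (subst sum.reindex) (auto simp: inj_on_def vec_nth_inject)
    also have "\<dots> \<le> (\<Sum>f\<in>PiE UNIV (\<lambda>_::'n. {- int R..int R}). \<Prod>j\<in>UNIV. g (f j))"
      using R by (intro sum_mono2 finite_PiE prod_nonneg) (auto simp: g0)
    also have "\<dots> = (\<Prod>j\<in>(UNIV::'n set). \<Sum>i\<in>{- int R..int R}. g i)"
      by (rule prod_sum_PiE[symmetric]) auto
    also have "\<dots> \<le> (\<Prod>j\<in>(UNIV::'n set). S)"
      using S by (intro prod_mono) (auto simp: g_def intro!: sum_nonneg)
    finally show ?thesis by simp
  qed
  show ?thesis
    by (rule nonneg_bdd_above_summable_on) (auto intro!: bdd_aboveI2 bound)
qed

text \<open>As \<open>weight m\<close> is at least 1, a real exponent may be rounded up to a natural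
  number, negative ones to 0. The product form lets the closure properties be proved with ordinary
  powers in place of \<open>powr\<close>.\<close>

lemma rapidly_decreasing_iff:
  "c \<in> rapidly_decreasing \<longleftrightarrow> (\<forall>p::nat. \<exists>C. \<forall>m. weight m ^ p * cmod (c m) \<le> C)"
proof
  assume c: "c \<in> rapidly_decreasing"
  show "\<forall>p::nat. \<exists>C. \<forall>m. weight m ^ p * cmod (c m) \<le> C"
  proof
    fix p :: nat
    obtain C where C: "\<And>m. cmod (c m) \<le> C * weight m powr (- real p)"
      using c unfolding rapidly_decreasing_def by blast
    have "weight m ^ p * cmod (c m) \<le> C" for m
      using C[of m] weight_pos[of m]
      by (simp add: powr_minus powr_realpow divide_simps mult.commute)
    then show "\<exists>C. \<forall>m. weight m ^ p * cmod (c m) \<le> C" by blast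
  qed
next
  assume *: "\<forall>p::nat. \<exists>C. \<forall>m. weight m ^ p * cmod (c m) \<le> C"
  show "c \<in> rapidly_decreasing"
    unfolding rapidly_decreasing_def
  proof (intro CollectI allI)
    fix M :: real
    define p where "p = nat \<lceil>M\<rceil>"
    obtain C where C: "\<And>m. weight m ^ p * cmod (c m) \<le> C" using * by blast
    have C0: "0 \<le> C" by (rule order.trans[OF _ C[of 0]]) simp
    have "cmod (c m) \<le> C * weight m powr (- M)" for m
    proof -
      have "cmod (c m) \<le> C * weight m powr (- real p)"
        using C[of m] weight_pos[of m]
        by (simp add: powr_minus powr_realpow divide_simps mult.commute)
      also have "\<dots> \<le> C * weight m powr (- M)"
        using C0 by (intro mult_left_mono powr_mono) (auto simp: p_def, linarith)
      finally show ?thesis .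
    qed
    then show "\<exists>C. \<forall>m. cmod (c m) \<le> C * weight m powr (- M)" by blast
  qed
qed

lemma rapidly_decreasingE:
  assumes "c \<in> rapidly_decreasing"
  obtains C where "C > 0" "\<And>m. weight m ^ p * cmod (c m) \<le> C"
proof -
  obtain C where C: "\<And>m. weight m ^ p * cmod (c m) \<le> C"
    using assms unfolding rapidly_decreasing_iff by blast
  have "weight m ^ p * cmod (c m) \<le> max C 1" for m using C[of m] by linarith
  then show ?thesis using that[of "max C 1"] by simp
qed

text \<open>The bound on the sum is linear in C, with a factor depending on the dimension alone: in
  the remainder estimate C contains a power of \<open>weight k\<close>, and this dependence has to
  survive the summation.\<close>

lemma abs_summable_on_weight:
  fixes f :: "int ^ 'n::finite \<Rightarrow> 'b::banach"
  assumes "\<And>m. weight m ^ (2 * CARD('n)) * norm (f m) \<le> C"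
  shows "(\<lambda>m. norm (f m)) summable_on UNIV"
    and "(\<Sum>\<^sub>\<infinity>m. norm (f m)) \<le> C * (\<Sum>\<^sub>\<infinity>m::int ^ 'n. 1 / weight m ^ (2 * CARD('n)))"
proof -
  have le: "norm (f m) \<le> C * (1 / weight m ^ (2 * CARD('n)))" for m
    using assms[of m] weight_pos[of m]
    by (simp add: divide_simps mult.commute)
  have s: "(\<lambda>m. C * (1 / weight (m :: int ^ 'n) ^ (2 * CARD('n)))) summable_on UNIV"
    by (intro summable_on_cmult_right summable_on_inverse_weight_power)
  then show *: "(\<lambda>m. norm (f m)) summable_on UNIV"
    by (rule summable_on_comparison_test) (use le in auto)
  have "(\<Sum>\<^sub>\<infinity>m. norm (f m)) \<le> (\<Sum>\<^sub>\<infinity>m. C * (1 / weight (m :: int ^ 'n) ^ (2 * CARD('n))))"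
    by (rule infsum_mono[OF * s]) (rule le)
  then show "(\<Sum>\<^sub>\<infinity>m. norm (f m)) \<le> C * (\<Sum>\<^sub>\<infinity>m::int ^ 'n. 1 / weight m ^ (2 * CARD('n)))"
    by (subst (asm) infsum_cmult_right) (auto intro: summable_on_inverse_weight_power)
qed

lemma rapidly_decreasing_abs_summable:
  fixes c :: "int ^ 'n::finite \<Rightarrow> complex"
  assumes "c \<in> rapidly_decreasing"
  shows "(\<lambda>m. norm (c m)) summable_on UNIV"
  using rapidly_decreasingE[OF assms, of "2 * CARD('n)"] abs_summable_on_weight(1)[of c] by metis

lemma rapidly_decreasing_zero [simp]: "(\<lambda>_. 0) \<in> rapidly_decreasing"
  by (auto simp: rapidly_decreasing_iff)

lemma rapidly_decreasing_poly_bound: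
  assumes c: "c \<in> rapidly_decreasing" and q: "\<And>m. cmod (q m) \<le> B * weight m ^ d"
  shows "(\<lambda>m. q m * c m) \<in> rapidly_decreasing"
  unfolding rapidly_decreasing_iff
proof
  fix p :: nat
  obtain C where C: "C > 0" "\<And>m. weight m ^ (p + d) * cmod (c m) \<le> C"
    using rapidly_decreasingE[OF c, of "p + d"] by blast
  have B0: "0 \<le> B" using order.trans[OF norm_ge_zero q[of 0]] by simp
  have "weight m ^ p * cmod (q m * c m) \<le> B * C" for m
  proof -
    have "weight m ^ p * cmod (q m * c m) \<le> weight m ^ p * ((B * weight m ^ d) * cmod (c m))"
      unfolding norm_mult by (intro mult_left_mono mult_right_mono q) auto
    also have "\<dots> = B * (weight m ^ (p + d) * cmod (c m))" by (simp add: power_add)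
    also have "\<dots> \<le> B * C" using B0 C(2) by (intro mult_left_mono)
    finally show ?thesis .
  qed
  then show "\<exists>C. \<forall>m. weight m ^ p * cmod (q m * c m) \<le> C" by blast
qed

lemma rapidly_decreasing_cmult:
  "c \<in> rapidly_decreasing \<Longrightarrow> (\<lambda>m. a * c m) \<in> rapidly_decreasing"
  using rapidly_decreasing_poly_bound[of c "\<lambda>_. a" "cmod a" 0] by simp

lemma rapidly_decreasing_coord:
  "c \<in> rapidly_decreasing \<Longrightarrow> (\<lambda>m. of_int (m $ j) * c m) \<in> rapidly_decreasing"
proof (rule rapidly_decreasing_poly_bound[where B = 1 and d = 1])
  fix m :: "int ^ 'a"
  show "cmod (of_int (m $ j)) \<le> 1 * weight m ^ 1"
    using abs_coord_le_lattice_norm[of m j] by simp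
qed

lemma rapidly_decreasing_add:
  assumes "c \<in> rapidly_decreasing" "d \<in> rapidly_decreasing"
  shows "(\<lambda>m. c m + d m) \<in> rapidly_decreasing"
  unfolding rapidly_decreasing_iff
proof
  fix p :: nat
  obtain C D where C: "\<And>m. weight m ^ p * cmod (c m) \<le> C" "\<And>m. weight m ^ p * cmod (d m) \<le> D"
    using rapidly_decreasingE[OF assms(1), of p] rapidly_decreasingE[OF assms(2), of p] by metis
  have "weight m ^ p * cmod (c m + d m) \<le> C + D" for m
  proof -
    have "weight m ^ p * cmod (c m + d m) \<le> weight m ^ p * (cmod (c m) + cmod (d m))"
      by (intro mult_left_mono norm_triangle_ineq) auto
    also have "\<dots> \<le> C + D" using C(1)[of m] C(2)[of m] by (simp add: distrib_left)
    finally show ?thesis .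
  qed
  then show "\<exists>C. \<forall>m. weight m ^ p * cmod (c m + d m) \<le> C" by blast
qed

lemma rapidly_decreasing_diff:
  "c \<in> rapidly_decreasing \<Longrightarrow> d \<in> rapidly_decreasing \<Longrightarrow> (\<lambda>m. c m - d m) \<in> rapidly_decreasing"
  using rapidly_decreasing_add[of c "\<lambda>m. - 1 * d m"] rapidly_decreasing_cmult[of d "- 1"] by simp

lemma rapidly_decreasing_sum:
  "(\<And>i. i \<in> I \<Longrightarrow> c i \<in> rapidly_decreasing) \<Longrightarrow> (\<lambda>m. \<Sum>i\<in>I. c i m) \<in> rapidly_decreasing"
  by (induction I rule: infinite_finite_induct) (auto intro: rapidly_decreasing_add)

lemma rapidly_decreasing_cnj_uminus:
  assumes "c \<in> rapidly_decreasing"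
  shows "(\<lambda>m. cnj (c (- m))) \<in> rapidly_decreasing"
  unfolding rapidly_decreasing_iff
proof
  fix p :: nat
  obtain C where C: "\<And>m. weight m ^ p * cmod (c m) \<le> C"
    using rapidly_decreasingE[OF assms, of p] by blast
  have "weight m ^ p * cmod (cnj (c (- m))) \<le> C" for m
    using C[of "- m"] by simp
  then show "\<exists>C. \<forall>m. weight m ^ p * cmod (cnj (c (- m))) \<le> C" by blast
qed


subsection \<open>Absolutely convergent Fourier series\<close>

lemma character_add_left: "character (k + l) x = character k x * character l x"
  by (simp add: character_def inner_add_left algebra_simps exp_add)

lemma character_add_right: "character k (x + y) = character k x * character k y"
  by (simp add: character_def inner_add_right algebra_simps exp_add)

lemma character_0 [simp]: "character 0 x = 1" "character k 0 = 1"
  by (simp_all add: character_def)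

lemma norm_character [simp]: "cmod (character k x) = 1"
  by (simp add: character_def)

lemma character_uminus: "character (- k) x = cnj (character k x)"
  by (simp add: character_def exp_cnj)

lemma character_of_lattice [simp]: "character k (of_lattice m) = 1"
proof -
  define N where "N = (\<Sum>j\<in>UNIV. k $ j * m $ j)"
  have "of_lattice k \<bullet> of_lattice m = real_of_int N"
    by (simp add: N_def inner_vec_def of_lattice_def)
  then have "character k (of_lattice m) = exp (of_real (2 * of_int N * pi) * \<i>)"
    unfolding character_def by (simp add: mult_ac)
  also have "\<dots> = 1"
    by (rule exp_integer_2pi) simp
  finally show ?thesis .
qed

lemma continuous_on_character [continuous_intros]:
  "continuous_on S f \<Longrightarrow> continuous_on S (\<lambda>x. character k (f x))"
  unfolding character_def by (intro continuous_intros)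

definition trig :: "(int ^ 'n::finite \<Rightarrow> complex) \<Rightarrow> real ^ 'n \<Rightarrow> complex" where
  "trig c x = (\<Sum>\<^sub>\<infinity>m. c m * character m x)"

lemma trig_abs_summable:
  assumes "(\<lambda>m. norm (c m)) summable_on UNIV"
  shows "(\<lambda>m. norm (c m * character m x)) summable_on UNIV"
  using assms by (simp add: norm_mult)

lemma trig_summable:
  "c \<in> rapidly_decreasing \<Longrightarrow> (\<lambda>m. c m * character m x) summable_on UNIV"
  by (rule abs_summable_summable[OF trig_abs_summable]) (rule rapidly_decreasing_abs_summable)

lemma trig_has_sum:
  "c \<in> rapidly_decreasing \<Longrightarrow> ((\<lambda>m. c m * character m x) has_sum trig c x) UNIV"
  unfolding trig_def by (intro has_sum_infsum trig_summable)

lemma trig_add: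
  "c \<in> rapidly_decreasing \<Longrightarrow> d \<in> rapidly_decreasing \<Longrightarrow>
   trig (\<lambda>m. c m + d m) x = trig c x + trig d x"
  using infsumI[OF has_sum_add[OF trig_has_sum trig_has_sum]]
  by (fastforce simp: trig_def algebra_simps)

lemma trig_cmult: "trig (\<lambda>m. a * c m) x = a * trig c x"
  unfolding trig_def mult.assoc by (rule infsum_cmult_right')

lemma trig_diff:
  "c \<in> rapidly_decreasing \<Longrightarrow> d \<in> rapidly_decreasing \<Longrightarrow>
   trig (\<lambda>m. c m - d m) x = trig c x - trig d x"
  using trig_add[of c "\<lambda>m. - 1 * d m" x] rapidly_decreasing_cmult[of d "- 1"]
    trig_cmult[of "- 1" d x] by simp

lemma trig_zero [simp]: "trig (\<lambda>_. 0) x = 0"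
  by (simp add: trig_def)

lemma trig_sum:
  "(\<And>i. i \<in> I \<Longrightarrow> c i \<in> rapidly_decreasing) \<Longrightarrow>
   trig (\<lambda>m. \<Sum>i\<in>I. c i m) x = (\<Sum>i\<in>I. trig (c i) x)"
  by (induction I rule: infinite_finite_induct)
     (auto simp: trig_add rapidly_decreasing_sum)

lemma norm_trig_le:
  assumes "(\<lambda>m. norm (c m)) summable_on UNIV"
  shows "cmod (trig c x) \<le> (\<Sum>\<^sub>\<infinity>m. cmod (c m))"
  unfolding trig_def
  using norm_infsum_bound[OF trig_abs_summable[OF assms, of x]]
  by (simp add: norm_mult)

lemma trig_cnj: "cnj (trig c x) = trig (\<lambda>m. cnj (c (- m))) x"
proof -
  have "trig (\<lambda>m. cnj (c (- m))) x = (\<Sum>\<^sub>\<infinity>m. cnj (c m * character m x))"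
    unfolding trig_def
    by (rule infsum_reindex_bij_witness[of _ uminus uminus]) (auto simp: character_uminus)
  then show ?thesis by (simp add: trig_def del: complex_cnj_mult)
qed

lemma trig_periodic [simp]: "trig c (x + of_lattice m) = trig c x"
  by (simp add: trig_def character_add_right)

text \<open>The bounded factor \<open>h\<close> prepares termwise integration against
  \<open>h\<close>; the choice \<open>h = 1\<close> gives continuity. Convergence is along the net
  of finite sets, matching \<open>infsum\<close>.\<close>

lemma uniform_limit_trig:
  fixes c :: "int ^ 'n::finite \<Rightarrow> complex"
  assumes "c \<in> rapidly_decreasing" and "\<And>x. x \<in> S \<Longrightarrow> cmod (h x) \<le> B"
  shows "uniform_limit S (\<lambda>F x. \<Sum>m\<in>F. c m * character m x * h x) (\<lambda>x. trig c x * h x)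
     (finite_subsets_at_top UNIV)"
proof -
  have "uniform_limit S (\<lambda>F x. \<Sum>m\<in>F. c m * character m x * h x)
     (\<lambda>x. \<Sum>\<^sub>\<infinity>m. c m * character m x * h x) (finite_subsets_at_top UNIV)"
  proof (rule Weierstrass_m_test_general)
    show "(\<lambda>m. cmod (c m) * B) summable_on UNIV"
      using rapidly_decreasing_abs_summable[OF assms(1)] by (intro summable_on_cmult_left)
    show "cmod (c m * character m x * h x) \<le> cmod (c m) * B" if "x \<in> S" for m x
      using assms(2)[OF that] by (simp add: norm_mult mult_left_mono)
  qed
  then show ?thesis
    by (simp add: trig_def infsum_cmult_left')
qed

lemma continuous_on_trig:
  assumes "c \<in> rapidly_decreasing"
  shows "continuous_on S (trig c)"
proof -
  have "continuous_on S (\<lambda>x. trig c x * 1)"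
    by (rule uniform_limit_theorem[OF _ uniform_limit_trig[OF assms, of S "\<lambda>_. 1" 1]])
       (auto intro!: always_eventually continuous_intros)
  then show ?thesis by simp
qed

section \<open>Termwise differentiation of Fourier series\<close>

lemma norm_exp_diff_linear_le: "cmod (exp (\<i> * of_real \<theta>) - 1 - \<i> * of_real \<theta>) \<le> \<theta>\<^sup>2"
proof -
  have "\<bar>sin \<theta> - \<theta>\<bar> \<le> \<theta>\<^sup>2 / 2"
    using Maclaurin_sin_bound[of \<theta> 2] by (simp add: numeral_2_eq_2 sin_coeff_def)
  moreover have "\<bar>cos \<theta> - 1\<bar> \<le> \<theta>\<^sup>2 / 2"
  proof -
    have "\<bar>sin (\<theta> / 2)\<bar>\<^sup>2 \<le> \<bar>\<theta> / 2\<bar>\<^sup>2"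
      by (intro power_mono abs_sin_x_le_abs_x) auto
    then show ?thesis
      using cos_double_sin[of "\<theta> / 2"] by (simp add: power_divide)
  qed
  ultimately show ?thesis
    using cmod_le[of "exp (\<i> * of_real \<theta>) - 1 - \<i> * of_real \<theta>"]
    by (simp add: Re_exp Im_exp)
qed

text \<open>By the second order bound for the exponential, the m-th term deviates from its linear
  part by at most t^2 times a coefficient with two extra factors m_j. These coefficients
  (\<open>e\<close>, up to a constant) are still summable, so the whole error is at most t^2
  E.\<close>

lemma has_vector_derivative_trig:
  assumes c: "c \<in> rapidly_decreasing"
  shows "((\<lambda>t. trig c (x + t *\<^sub>R axis j 1)) has_vector_derivative
    trig (\<lambda>m. 2 * of_real pi * \<i> * (of_int (m $ j) * c m)) x) (at 0)"
proof -
  define d where "d m = 2 * of_real pi * \<i> * (of_int (m $ j) * c m)" for m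
  define e where "e m = of_int (m $ j) * (of_int (m $ j) * c m)" for m
  have d: "d \<in> rapidly_decreasing"
    unfolding d_def by (intro rapidly_decreasing_cmult rapidly_decreasing_coord c)
  have e: "(\<lambda>m. of_real a * e m) \<in> rapidly_decreasing" for a
    unfolding e_def by (intro rapidly_decreasing_cmult rapidly_decreasing_coord c)
  define E where "E = (\<Sum>\<^sub>\<infinity>m. cmod (of_real ((2 * pi)\<^sup>2) * e m))"
  have bound: "cmod (trig c (x + t *\<^sub>R axis j 1) - trig c x - of_real t * trig d x) \<le> t\<^sup>2 * E" for t
  proof -
    have hs: "((\<lambda>m. c m * character m (x + t *\<^sub>R axis j 1) - c m * character m x
        - of_real t * (d m * character m x)) has_sum
        (trig c (x + t *\<^sub>R axis j 1) - trig c x - of_real t * trig d x)) UNIV"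
      unfolding diff_conv_add_uminus
      by (intro has_sum_add has_sum_uminusI has_sum_cmult_right trig_has_sum c d)
    have s: "(\<lambda>m. t\<^sup>2 * cmod (of_real ((2 * pi)\<^sup>2) * e m)) summable_on UNIV"
      by (intro summable_on_cmult_right rapidly_decreasing_abs_summable e)
    have le: "cmod (c m * character m (x + t *\<^sub>R axis j 1) - c m * character m x
        - of_real t * (d m * character m x)) \<le> t\<^sup>2 * cmod (of_real ((2 * pi)\<^sup>2) * e m)" for m
    proof -
      define \<theta> where "\<theta> = 2 * pi * real_of_int (m $ j) * t"
      have "of_lattice m \<bullet> axis j 1 = real_of_int (m $ j)"
        by (simp add: inner_axis of_lattice_def)
      then have ch: "character m (x + t *\<^sub>R axis j 1) = character m x * exp (\<i> * of_real \<theta>)"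
        unfolding character_add_right by (simp add: character_def \<theta>_def mult_ac)
      have "c m * character m (x + t *\<^sub>R axis j 1) - c m * character m x
        - of_real t * (d m * character m x) = c m * character m x * (exp (\<i> * of_real \<theta>) - 1 - \<i> * of_real \<theta>)"
        unfolding ch d_def \<theta>_def by (simp add: algebra_simps)
      then have "cmod (c m * character m (x + t *\<^sub>R axis j 1) - c m * character m x
        - of_real t * (d m * character m x)) = cmod (c m) * cmod (exp (\<i> * of_real \<theta>) - 1 - \<i> * of_real \<theta>)"
        by (simp add: norm_mult)
      also have "\<dots> \<le> cmod (c m) * \<theta>\<^sup>2"
        by (intro mult_left_mono norm_exp_diff_linear_le) auto
      also have "\<dots> = t\<^sup>2 * cmod (of_real ((2 * pi)\<^sup>2) * e m)"
        unfolding \<theta>_def e_def by (simp add: norm_mult power_mult_distrib power2_eq_square norm_power)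
      finally show ?thesis .
    qed
    have "cmod (trig c (x + t *\<^sub>R axis j 1) - trig c x - of_real t * trig d x) \<le>
        (\<Sum>\<^sub>\<infinity>m. t\<^sup>2 * cmod (of_real ((2 * pi)\<^sup>2) * e m))"
      using norm_infsum_le[OF hs has_sum_infsum[OF s] le] by simp
    then show ?thesis unfolding E_def by (simp add: infsum_cmult_right')
  qed
  have "((\<lambda>t. trig c (x + t *\<^sub>R axis j 1)) has_derivative (\<lambda>t. t *\<^sub>R trig d x)) (at 0)"
    unfolding has_derivative_at
  proof (intro conjI bounded_linear_scaleR_left)
    show "(\<lambda>h. norm (trig c (x + (0 + h) *\<^sub>R axis j 1) - trig c (x + 0 *\<^sub>R axis j 1)
        - h *\<^sub>R trig d x) / norm h) \<midarrow>0\<rightarrow> 0"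
    proof (rule Lim_null_comparison)
      show "\<forall>\<^sub>F h in at 0. norm (norm (trig c (x + (0 + h) *\<^sub>R axis j 1) - trig c (x + 0 *\<^sub>R axis j 1)
        - h *\<^sub>R trig d x) / norm h) \<le> \<bar>h\<bar> * E"
      proof (rule eventually_mono[OF eventually_at_ball[of 1]])
        fix h :: real
        show "norm (norm (trig c (x + (0 + h) *\<^sub>R axis j 1) - trig c (x + 0 *\<^sub>R axis j 1)
        - h *\<^sub>R trig d x) / norm h) \<le> \<bar>h\<bar> * E"
          using bound[of h] by (auto simp: divide_simps scaleR_conv_of_real power2_eq_square mult_ac)
      qed simp
      have "(\<lambda>h::real. \<bar>h\<bar> * E) \<midarrow>0\<rightarrow> \<bar>0\<bar> * E" by (intro tendsto_intros)
      then show "(\<lambda>h::real. \<bar>h\<bar> * E) \<midarrow>0\<rightarrow> 0" by simp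
    qed
  qed
  then show ?thesis unfolding has_vector_derivative_def d_def .
qed

lemma partial_deriv_trig:
  "c \<in> rapidly_decreasing \<Longrightarrow>
   partial_deriv j (trig c) = trig (\<lambda>m. 2 * of_real pi * \<i> * (of_int (m $ j) * c m))"
  unfolding partial_deriv_def
  by (rule ext) (rule vector_derivative_at[OF has_vector_derivative_trig])

lemma cont_diff_trig: "c \<in> rapidly_decreasing \<Longrightarrow> cont_diff r (trig c)"
proof (induction r arbitrary: c)
  case 0
  then show ?case by (simp add: continuous_on_trig)
next
  case (Suc r)
  have "(\<lambda>t. trig c (x + t *\<^sub>R axis j 1)) differentiable at 0" for x j
    using has_vector_derivative_trig[OF Suc.prems] differentiableI_vector by blast
  moreover have "cont_diff r (partial_deriv j (trig c))" for j
    unfolding partial_deriv_trig[OF Suc.prems]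
    by (intro Suc.IH rapidly_decreasing_cmult rapidly_decreasing_coord Suc.prems)
  ultimately show ?case by simp
qed

lemma smooth_on_torus_trig: "c \<in> rapidly_decreasing \<Longrightarrow> smooth_on_torus (trig c)"
  by (simp add: smooth_on_torus_def cont_diff_trig)


subsection \<open>Fourier coefficients of smooth functions\<close>

text \<open>Translation moves the cube along axis j. The slab of the moved cube beyond x_j = 1 is
  the translate by one period of the slab 0 \<le> x_j \<le> t that is missing at the other
  end.\<close>

lemma integral_translate_axis:
  fixes F :: "real ^ 'n::finite \<Rightarrow> complex"
  assumes cont: "continuous_on UNIV F" and per: "\<And>x. F (x + axis j 1) = F x"
    and t: "0 \<le> t" "t \<le> 1"
  shows "integral (cbox 0 1) (\<lambda>x. F (x + t *\<^sub>R axis j 1)) = integral (cbox 0 1) F"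
proof -
  define e :: "real ^ 'n" where "e = axis j 1"
  have e_nth: "e $ i = (if i = j then 1 else 0)" for i
    by (simp add: e_def axis_def)
  have e_Basis: "e \<in> Basis" by (simp add: e_def axis_in_Basis_iff)
  have inner_e: "x \<bullet> e = x $ j" for x by (simp add: e_def inner_axis)
  have int: "F integrable_on cbox a b" for a b
    by (intro integrable_continuous continuous_on_subset[OF cont]) auto
  have "integral (cbox 0 1) (\<lambda>x. F (x + t *\<^sub>R e)) = integral (cbox (t *\<^sub>R e) (1 + t *\<^sub>R e)) F"
    using integral_shift_cbox[of "t *\<^sub>R e" "t *\<^sub>R e" "1 + t *\<^sub>R e" F] by simp
  also have "\<dots> = integral (cbox (t *\<^sub>R e) (1 + t *\<^sub>R e) \<inter> {x. x \<bullet> e \<le> 1}) F +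
      integral (cbox (t *\<^sub>R e) (1 + t *\<^sub>R e) \<inter> {x. x \<bullet> e \<ge> 1}) F"
    by (rule integral_split[OF int e_Basis])
  also have "cbox (t *\<^sub>R e) (1 + t *\<^sub>R e) \<inter> {x. x \<bullet> e \<le> 1} = cbox (t *\<^sub>R e) 1"
    using t by (force simp: mem_box_cart inner_e e_nth split: if_splits)
  also have "cbox (t *\<^sub>R e) (1 + t *\<^sub>R e) \<inter> {x. x \<bullet> e \<ge> 1} = cbox e (1 + t *\<^sub>R e)"
    using t by (force simp: mem_box_cart inner_e e_nth split: if_splits)
  also have "integral (cbox e (1 + t *\<^sub>R e)) F = integral (cbox 0 (1 + t *\<^sub>R e - e)) F"
    using integral_shift_cbox[of e e "1 + t *\<^sub>R e" F] per by (simp add: e_def)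
  also have "cbox 0 (1 + t *\<^sub>R e - e) = cbox 0 1 \<inter> {x. x \<bullet> e \<le> t}"
    using t by (force simp: mem_box_cart inner_e e_nth split: if_splits)
  also have "cbox (t *\<^sub>R e) 1 = cbox 0 1 \<inter> {x. x \<bullet> e \<ge> t}"
  proof (rule set_eqI)
    fix x
    show "x \<in> cbox (t *\<^sub>R e) 1 \<longleftrightarrow> x \<in> cbox 0 1 \<inter> {x. x \<bullet> e \<ge> t}"
      unfolding mem_box_cart Int_iff mem_Collect_eq inner_e using t
      by (simp add: e_nth) (smt (verit))
  qed
  also have "integral (cbox 0 1 \<inter> {x. x \<bullet> e \<ge> t}) F + integral (cbox 0 1 \<inter> {x. x \<bullet> e \<le> t}) F =
      integral (cbox 0 1) F"
    using integral_split[OF int e_Basis, of 0 1 t] by simp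
  finally show ?thesis by (simp add: e_def)
qed

text \<open>The integral of the translates of F is constant in t, and differentiating under the
  integral sign at t = 0 gives the integral of G. Orthogonality of the characters and integration by
  parts both rest on this.\<close>

lemma integral_periodic_derivative_eq_0:
  fixes F :: "real ^ 'n::finite \<Rightarrow> complex"
  assumes F: "continuous_on UNIV F" and G: "continuous_on UNIV G"
    and per: "\<And>x. F (x + axis j 1) = F x"
    and deriv: "\<And>x. ((\<lambda>t. F (x + t *\<^sub>R axis j 1)) has_vector_derivative G x) (at 0)"
  shows "integral (cbox 0 1) G = 0"
proof -
  define e :: "real ^ 'n" where "e = axis j 1"
  have deriv': "((\<lambda>t. F (x + t *\<^sub>R e)) has_vector_derivative G (x + s *\<^sub>R e)) (at s within S)" for x s S
  proof -
    have "(((\<lambda>t. F ((x + s *\<^sub>R e) + t *\<^sub>R e)) \<circ> (\<lambda>t. t - s)) has_vector_derivative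
        1 *\<^sub>R G (x + s *\<^sub>R e)) (at s)"
      using deriv[of "x + s *\<^sub>R e"]
      by (intro vector_diff_chain_at) (auto intro!: derivative_eq_intros simp: e_def)
    then show ?thesis
      by (auto simp: o_def algebra_simps intro: has_vector_derivative_at_within)
  qed
  \<comment> \<open>The derivative is one-sided, within [0, 1], because translation invariance is
    available only for these t.\<close>
  have "((\<lambda>t. integral (cbox 0 1) (\<lambda>x. F (x + t *\<^sub>R e))) has_vector_derivative
      integral (cbox 0 1) (\<lambda>x. G (x + 0 *\<^sub>R e))) (at 0 within cbox 0 1)"
  proof (rule leibniz_rule_vector_derivative[where fx = "\<lambda>t x. G (x + t *\<^sub>R e)"])
    show "(\<lambda>x. F (x + t *\<^sub>R e)) integrable_on cbox 0 1" for t
      by (intro integrable_continuous continuous_on_compose2[OF F] continuous_intros) auto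
    show "continuous_on (cbox 0 1 \<times> cbox 0 1) (\<lambda>(t, x). G (x + t *\<^sub>R e))"
      unfolding case_prod_beta
      by (intro continuous_on_compose2[OF G] continuous_intros) auto
  qed (auto intro: deriv')
  moreover have "((\<lambda>t. integral (cbox 0 1) (\<lambda>x. F (x + t *\<^sub>R e))) has_vector_derivative 0)
      (at 0 within cbox 0 1)"
  proof (rule has_vector_derivative_transform)
    show "((\<lambda>t. integral (cbox 0 1) F) has_vector_derivative 0) (at 0 within cbox 0 1)"
      by (rule has_vector_derivative_const)
    show "integral (cbox 0 1) (\<lambda>x. F (x + t *\<^sub>R e)) = integral (cbox 0 1) F" if "t \<in> cbox 0 1" for t
      using that integral_translate_axis[OF F per, of t] by (simp add: e_def)
  qed auto
  ultimately have "integral (cbox 0 1) (\<lambda>x. G (x + 0 *\<^sub>R e)) = 0"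
    by (rule vector_derivative_unique_within_closed_interval[of 0 1 0, rotated 2]) auto
  then show ?thesis by simp
qed

lemma has_vector_derivative_character:
  "((\<lambda>t. character m (x + t *\<^sub>R axis j 1)) has_vector_derivative
    2 * of_real pi * \<i> * of_int (m $ j) * character m x) (at 0)"
proof -
  define a where "a = 2 * of_real pi * \<i> * complex_of_int (m $ j)"
  have "of_lattice m \<bullet> axis j 1 = real_of_int (m $ j)"
    by (simp add: inner_axis of_lattice_def)
  then have "(\<lambda>t. character m (x + t *\<^sub>R axis j 1)) = (\<lambda>t. character m x * exp (t *\<^sub>R a))"
    unfolding character_add_right a_def scaleR_conv_of_real[where 'a = complex]
    by (simp add: character_def mult_ac)
  moreover have "((\<lambda>t. character m x * exp (t *\<^sub>R a)) has_vector_derivative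
      character m x * (exp (0 *\<^sub>R a) * a)) (at 0)"
    by (intro has_vector_derivative_mult_right exp_scaleR_has_vector_derivative_right)
  ultimately show ?thesis by (simp add: a_def mult_ac)
qed

lemma content_unit_cbox_cart: "measure lborel (cbox 0 (1 :: real ^ 'n::finite)) = 1"
proof -
  have "0 \<in> cbox 0 (1 :: real ^ 'n)" by (simp add: mem_box_cart)
  then have "cbox 0 (1 :: real ^ 'n) \<noteq> {}" by blast
  then show ?thesis by (simp add: content_cbox_if_cart)
qed

lemma integral_character: "integral (cbox 0 1) (character m) = (if m = 0 then 1 else 0)"
proof (cases "m = 0")
  case True
  have "character m = (\<lambda>_. 1)" by (simp add: True fun_eq_iff)
  then show ?thesis by (simp add: True content_unit_cbox_cart)
next
  case False
  then obtain j where j: "m $ j \<noteq> 0" by (auto simp: vec_eq_iff)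
  have "integral (cbox 0 1) (\<lambda>x. 2 * of_real pi * \<i> * of_int (m $ j) * character m x) = 0"
  proof (rule integral_periodic_derivative_eq_0)
    show "character m (x + axis j 1) = character m x" for x
      using character_of_lattice[of m "axis j 1"] by (simp add: character_add_right)
  qed (auto intro!: continuous_intros has_vector_derivative_character)
  then show ?thesis using j False by simp
qed

definition fourier_coeff :: "(real ^ 'n::finite \<Rightarrow> complex) \<Rightarrow> int ^ 'n \<Rightarrow> complex" where
  "fourier_coeff f m = integral (cbox 0 1) (\<lambda>x. f x * character (- m) x)"

lemma integrable_continuous_UNIV:
  fixes f :: "'a::euclidean_space \<Rightarrow> 'b::banach"
  shows "continuous_on UNIV f \<Longrightarrow> f integrable_on cbox a b"
  by (rule integrable_continuous) (rule continuous_on_subset, auto)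

lemma norm_fourier_coeff_le:
  fixes f :: "real ^ 'n::finite \<Rightarrow> complex"
  assumes "continuous_on UNIV f" and "\<And>x. cmod (f x) \<le> B"
  shows "cmod (fourier_coeff f m) \<le> B"
proof -
  have "0 \<le> B" by (rule order.trans[OF _ assms(2)[of 0]]) simp
  then have "cmod (fourier_coeff f m) \<le> B * measure lborel (cbox 0 (1 :: real ^ 'n))"
    unfolding fourier_coeff_def using assms
    by (intro has_integral_bound[OF _ integrable_integral[OF integrable_continuous_UNIV]])
       (auto intro!: continuous_intros simp: norm_mult)
  then show ?thesis by (simp add: content_unit_cbox_cart)
qed

lemma integral_trig_has_sum:
  assumes c: "c \<in> rapidly_decreasing" and h: "continuous_on UNIV h"
  shows "((\<lambda>m. c m * integral (cbox 0 1) (\<lambda>x. character m x * h x)) has_sum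
    integral (cbox 0 1) (\<lambda>x. trig c x * h x)) UNIV"
proof -
  have "compact (h ` cbox 0 1)"
    by (intro compact_continuous_image continuous_on_subset[OF h]) auto
  then obtain B where B: "\<And>x. x \<in> cbox 0 1 \<Longrightarrow> cmod (h x) \<le> B"
    using compact_imp_bounded[of "h ` cbox 0 1"] by (auto simp: bounded_iff)
  have cont: "continuous_on UNIV (\<lambda>x. character m x * h x)" for m
    by (intro continuous_intros h)
  obtain I J where I: "\<And>F. ((\<lambda>x. \<Sum>m\<in>F. c m * character m x * h x) has_integral I F) (cbox 0 1)"
    and J: "((\<lambda>x. trig c x * h x) has_integral J) (cbox 0 1)"
    and lim: "(I \<longlongrightarrow> J) (finite_subsets_at_top UNIV)"
    by (rule uniform_limit_integral_cbox[OF uniform_limit_trig[OF c B]])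
       (auto intro!: continuous_intros continuous_on_subset[OF h])
  have "I F = (\<Sum>m\<in>F. c m * integral (cbox 0 1) (\<lambda>x. character m x * h x))" for F
  proof (cases "finite F")
    case True
    then have "((\<lambda>x. \<Sum>m\<in>F. c m * (character m x * h x)) has_integral
       (\<Sum>m\<in>F. c m * integral (cbox 0 1) (\<lambda>x. character m x * h x))) (cbox 0 1)"
      by (intro has_integral_sum has_integral_mult_right integrable_integral
          integrable_continuous_UNIV cont)
    then show ?thesis
      using I[of F] by (intro has_integral_unique[OF I]) (simp add: mult_ac)
  next
    \<comment> \<open>A \<open>sum\<close> over an infinite set is 0, here on both sides. The
      identity is wanted for all \<open>F\<close> so that it becomes an equality of functions of
      \<open>F\<close>.\<close>
    case False
    then show ?thesis using I[of F] by (simp add: has_integral_0_eq)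
  qed
  then have "I = sum (\<lambda>m. c m * integral (cbox 0 1) (\<lambda>x. character m x * h x))" by blast
  then show ?thesis
    using lim integral_unique[OF J] by (simp add: has_sum_def)
qed

lemma fourier_coeff_trig:
  assumes "c \<in> rapidly_decreasing"
  shows "fourier_coeff (trig c) m = c m"
proof -
  have "((\<lambda>l. c l * integral (cbox 0 1) (\<lambda>x. character l x * character (- m) x)) has_sum
      fourier_coeff (trig c) m) UNIV"
    unfolding fourier_coeff_def
    by (intro integral_trig_has_sum assms continuous_intros)
  also have "(\<lambda>l. c l * integral (cbox 0 1) (\<lambda>x. character l x * character (- m) x)) =
      (\<lambda>l. if l = m then c m else 0)"
    by (rule ext) (simp add: integral_character flip: character_add_left)
  finally have "((\<lambda>l. if l = m then c m else 0) has_sum fourier_coeff (trig c) m) UNIV" .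
  moreover have "((\<lambda>l. if l = m then c m else 0) has_sum c m) UNIV"
    by (rule has_sum_finite_neutralI[of "{m}"]) auto
  ultimately show ?thesis by (rule has_sum_unique)
qed

text \<open>Passing from a supremum bound to the coefficients loses nothing, since the cube has
  volume one and characters have modulus one.\<close>

lemma norm_coeff_le_trig:
  assumes "c \<in> rapidly_decreasing" "\<And>x. cmod (trig c x) \<le> B"
  shows "cmod (c m) \<le> B"
  using norm_fourier_coeff_le[OF continuous_on_trig[OF assms(1)] assms(2)]
    fourier_coeff_trig[OF assms(1)] by metis

section \<open>Decay of the coefficients under smoothness\<close>

lemma smooth_on_torus_continuous: "smooth_on_torus f \<Longrightarrow> continuous_on UNIV f"
  unfolding smooth_on_torus_def using cont_diff.simps(1) by blast

lemma smooth_on_torus_has_vector_derivative: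
  assumes "smooth_on_torus f"
  shows "((\<lambda>t. f (x + t *\<^sub>R axis j 1)) has_vector_derivative partial_deriv j f x) (at 0)"
proof -
  have "cont_diff (Suc 0) f" using assms unfolding smooth_on_torus_def by blast
  then show ?thesis unfolding partial_deriv_def cont_diff.simps(2) vector_derivative_works by blast
qed

lemma smooth_on_torus_partial_deriv:
  assumes "smooth_on_torus f"
  shows "smooth_on_torus (partial_deriv j f)"
proof -
  have "f (x + of_lattice m) = f x" for x m
    using assms unfolding smooth_on_torus_def by blast
  then have "f (x + of_lattice m + t *\<^sub>R axis j 1) = f (x + t *\<^sub>R axis j 1)" for x m t
    by (metis add.assoc add.commute)
  moreover have "cont_diff r (partial_deriv j f)" for r
    using assms unfolding smooth_on_torus_def by (metis cont_diff.simps(2))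
  ultimately show ?thesis
    unfolding smooth_on_torus_def by (simp add: partial_deriv_def)
qed

lemma smooth_on_torus_bounded:
  assumes "smooth_on_torus f"
  obtains B where "\<And>x. cmod (f x) \<le> B"
proof -
  have "compact (f ` cbox 0 1)"
    by (intro compact_continuous_image continuous_on_subset[OF smooth_on_torus_continuous[OF assms]]) auto
  then obtain B where B: "\<And>x. x \<in> cbox 0 1 \<Longrightarrow> cmod (f x) \<le> B"
    using compact_imp_bounded[of "f ` cbox 0 1"] by (auto simp: bounded_iff)
  have "cmod (f x) \<le> B" for x
  proof -
    define m where "m = (\<chi> j. \<lfloor>x $ j\<rfloor>)"
    have "x - of_lattice m \<in> cbox 0 1"
      by (auto simp: m_def of_lattice_def mem_box_cart, linarith)
    moreover have "f (x - of_lattice m + of_lattice m) = f (x - of_lattice m)"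
      using assms unfolding smooth_on_torus_def by blast
    ultimately show ?thesis using B by simp
  qed
  then show thesis by (rule that)
qed

text \<open>Integration by parts: f times the character of frequency -m is periodic, so the integral
  of its derivative vanishes.\<close>

lemma fourier_coeff_partial_deriv:
  assumes f: "smooth_on_torus f"
  shows "fourier_coeff (partial_deriv j f) m = 2 * of_real pi * \<i> * of_int (m $ j) * fourier_coeff f m"
proof -
  have per: "f (x + axis j 1) = f x" for x
    using f of_lattice_axis[of j] unfolding smooth_on_torus_def by metis
  note cont = smooth_on_torus_continuous[OF f]
    smooth_on_torus_continuous[OF smooth_on_torus_partial_deriv[OF f]]
  have "integral (cbox 0 1) (\<lambda>x. f x * (2 * of_real pi * \<i> * of_int ((- m) $ j) * character (- m) x)
      + partial_deriv j f x * character (- m) x) = 0"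
  proof (rule integral_periodic_derivative_eq_0)
    show "((\<lambda>t. f (x + t *\<^sub>R axis j 1) * character (- m) (x + t *\<^sub>R axis j 1)) has_vector_derivative
      f x * (2 * of_real pi * \<i> * of_int ((- m) $ j) * character (- m) x)
      + partial_deriv j f x * character (- m) x) (at 0)" for x
      using has_vector_derivative_mult[OF smooth_on_torus_has_vector_derivative[OF f]
        has_vector_derivative_character[of "- m" x j], of x j] by simp
    show "f (x + axis j 1) * character (- m) (x + axis j 1) = f x * character (- m) x" for x
      using character_of_lattice[of "- m" "axis j 1"] by (simp add: per character_add_right)
  qed (intro continuous_intros cont)+
  moreover have "integral (cbox 0 1) (\<lambda>x. f x * (2 * of_real pi * \<i> * of_int ((- m) $ j) * character (- m) x)
      + partial_deriv j f x * character (- m) x) =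
      integral (cbox 0 1) (\<lambda>x. (2 * of_real pi * \<i> * of_int ((- m) $ j)) * (f x * character (- m) x))
      + fourier_coeff (partial_deriv j f) m"
    unfolding fourier_coeff_def
    by (subst integral_add[symmetric])
       (auto intro!: integrable_continuous_UNIV continuous_intros cont simp: mult_ac)
  ultimately show ?thesis
    by (simp add: fourier_coeff_def)
qed

text \<open>The coordinate of largest modulus is chosen, and the norm is at most n times that
  modulus. Decay in m can therefore be tested with powers of one coordinate; \<open>j\<close>
  depends on \<open>m\<close>, so constants obtained this way must later be made uniform in
  \<open>j\<close>.\<close>

lemma weight_power_le:
  fixes m :: "int ^ 'n::finite"
  obtains j where "weight m ^ p \<le> (1 + real CARD('n)) ^ p * (1 + \<bar>real_of_int (m $ j)\<bar>) ^ p"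
proof -
  have "finite (range (\<lambda>j. \<bar>m $ j\<bar>))" by simp
  then obtain j where j: "\<And>i. \<bar>m $ i\<bar> \<le> \<bar>m $ j\<bar>"
    using Max_in[of "range (\<lambda>j. \<bar>m $ j\<bar>)"] Max_ge[of "range (\<lambda>j. \<bar>m $ j\<bar>)"]
    by (metis (no_types, lifting) empty_not_UNIV image_is_empty rangeE rangeI)
  have "lattice_norm m \<le> (\<Sum>i\<in>(UNIV::'n set). real_of_int \<bar>m $ i\<bar>)"
    using lattice_norm_le_l1_size[of m] by (simp only: of_nat_l1_size)
  also have "\<dots> \<le> (\<Sum>i\<in>(UNIV::'n set). real_of_int \<bar>m $ j\<bar>)"
    by (intro sum_mono of_int_le_iff[THEN iffD2] j)
  finally have "lattice_norm m \<le> real CARD('n) * \<bar>real_of_int (m $ j)\<bar>" by simp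
  then have "weight m \<le> (1 + real CARD('n)) * (1 + \<bar>real_of_int (m $ j)\<bar>)"
    by (simp add: algebra_simps)
  then have "weight m ^ p \<le> ((1 + real CARD('n)) * (1 + \<bar>real_of_int (m $ j)\<bar>)) ^ p"
    by (intro power_mono) auto
  then show thesis by (intro that[of j]) (simp add: power_mult_distrib)
qed

text \<open>Each derivative in direction j yields a factor m_j, so p derivatives bound |m_j|^p times
  the coefficient. The sum of the constants over all j serves for every m.\<close>

lemma fourier_coeff_rapidly_decreasing:
  fixes f :: "real ^ 'n::finite \<Rightarrow> complex"
  assumes "smooth_on_torus f"
  shows "fourier_coeff f \<in> rapidly_decreasing"
proof -
  have coord: "\<exists>B. \<forall>m. \<bar>real_of_int (m $ j)\<bar> ^ p * cmod (fourier_coeff g m) \<le> B"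
    if "smooth_on_torus g" for g and j :: 'n and p
    using that
  proof (induction p arbitrary: g)
    case 0
    obtain B where "\<And>x. cmod (g x) \<le> B" using smooth_on_torus_bounded[OF 0] by blast
    then show ?case
      using norm_fourier_coeff_le[OF smooth_on_torus_continuous[OF 0]] by auto
  next
    case (Suc p)
    obtain B where B: "\<And>m. \<bar>real_of_int (m $ j)\<bar> ^ p * cmod (fourier_coeff (partial_deriv j g) m) \<le> B"
      using Suc.IH[OF smooth_on_torus_partial_deriv[OF Suc.prems]] by blast
    have "\<bar>real_of_int (m $ j)\<bar> ^ Suc p * cmod (fourier_coeff g m) \<le> B" for m
    proof -
      have "\<bar>real_of_int (m $ j)\<bar> ^ Suc p * cmod (fourier_coeff g m) * 1 \<le>
          \<bar>real_of_int (m $ j)\<bar> ^ Suc p * cmod (fourier_coeff g m) * (2 * pi)"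
        using pi_gt3 by (intro mult_left_mono) auto
      also have "\<dots> = \<bar>real_of_int (m $ j)\<bar> ^ p * cmod (fourier_coeff (partial_deriv j g) m)"
        by (simp add: fourier_coeff_partial_deriv[OF Suc.prems] norm_mult)
      also have "\<dots> \<le> B" by (rule B)
      finally show ?thesis by simp
    qed
    then show ?case by blast
  qed
  show ?thesis
    unfolding rapidly_decreasing_iff
  proof
    fix p :: nat
    have "\<exists>B. \<forall>m. (1 + \<bar>real_of_int (m $ j)\<bar>) ^ p * cmod (fourier_coeff f m) \<le> B" for j
    proof -
      obtain B where B: "\<And>m. \<bar>real_of_int (m $ j)\<bar> ^ p * cmod (fourier_coeff f m) \<le> B"
        using coord[OF assms] by blast
      obtain B' where B': "\<And>m. cmod (fourier_coeff f m) \<le> B'"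
        using coord[OF assms, where p = 0] by auto
      have "(1 + \<bar>real_of_int (m $ j)\<bar>) ^ p * cmod (fourier_coeff f m) \<le> 2 ^ p * B + B'" for m
      proof -
        have B0: "0 \<le> B" "0 \<le> B'"
          by (rule order.trans[OF _ B[of 0]], simp, rule order.trans[OF _ B'[of 0]], simp)
        show ?thesis
        proof (cases "m $ j = 0")
          case True
          then show ?thesis using B'[of m] B0 by (auto simp: add_increasing)
        next
          case False
          then have "1 \<le> \<bar>real_of_int (m $ j)\<bar>" by linarith
          then have "(1 + \<bar>real_of_int (m $ j)\<bar>) ^ p \<le> (2 * \<bar>real_of_int (m $ j)\<bar>) ^ p"
            by (intro power_mono) auto
          then have "(1 + \<bar>real_of_int (m $ j)\<bar>) ^ p * cmod (fourier_coeff f m) \<le>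
              2 ^ p * (\<bar>real_of_int (m $ j)\<bar> ^ p * cmod (fourier_coeff f m))"
            by (metis mult.assoc mult_right_mono norm_ge_zero power_mult_distrib)
          also have "\<dots> \<le> 2 ^ p * B" by (intro mult_left_mono B) auto
          finally show ?thesis using B0 by simp
        qed
      qed
      then show ?thesis by blast
    qed
    then obtain B where B: "\<And>j m. (1 + \<bar>real_of_int (m $ j)\<bar>) ^ p * cmod (fourier_coeff f m) \<le> B j"
      by metis
    have B0: "0 \<le> B j" for j by (rule order.trans[OF _ B[of 0]]) simp
    have "weight m ^ p * cmod (fourier_coeff f m) \<le> (1 + real CARD('n)) ^ p * (\<Sum>j\<in>UNIV. B j)" for m
    proof -
      obtain j where "weight m ^ p \<le> (1 + real CARD('n)) ^ p * (1 + \<bar>real_of_int (m $ j)\<bar>) ^ p"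
        by (rule weight_power_le)
      then have "weight m ^ p * cmod (fourier_coeff f m) \<le>
          (1 + real CARD('n)) ^ p * (1 + \<bar>real_of_int (m $ j)\<bar>) ^ p * cmod (fourier_coeff f m)"
        by (intro mult_right_mono) auto
      also have "\<dots> \<le> (1 + real CARD('n)) ^ p * B j"
        unfolding mult.assoc by (intro mult_left_mono B) auto
      also have "\<dots> \<le> (1 + real CARD('n)) ^ p * (\<Sum>j\<in>UNIV. B j)"
        using B0 by (intro mult_left_mono member_le_sum) auto
      finally show ?thesis .
    qed
    then show "\<exists>C. \<forall>m. weight m ^ p * cmod (fourier_coeff f m) \<le> C" by blast
  qed
qed


subsection \<open>Fourier inversion\<close>

text \<open>
  The powers \<open>Q\<^sup>r\<close> concentrate at \<open>c\<close>: near \<open>c\<close> they exceed \<open>s\<^sup>r\<close>, away from \<open>c\<close> they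
  stay below \<open>q\<^sup>r\<close> for some \<open>q < s\<close>.
\<close>

lemma peak_function_nonpos:
  fixes u Q :: "'a::euclidean_space \<Rightarrow> real"
  assumes u: "continuous_on (cbox a b) u" and Q: "continuous_on (cbox a b) Q"
    and c: "c \<in> box a b" and Qc: "Q c = 1"
    and Q01: "\<And>x. x \<in> cbox a b \<Longrightarrow> x \<noteq> c \<Longrightarrow> 0 \<le> Q x \<and> Q x < 1"
    and zero: "\<And>r. integral (cbox a b) (\<lambda>x. Q x ^ r * u x) = 0"
  shows "u c \<le> 0"
proof (rule ccontr)
  assume "\<not> u c \<le> 0"
  then have uc: "0 < u c" by simp
  define K where "K = cbox a b"
  define \<epsilon> where "\<epsilon> = u c / 2"
  have \<epsilon>: "0 < \<epsilon>" "\<epsilon> < u c" using uc by (auto simp: \<epsilon>_def)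
  have cK: "c \<in> K" using c box_subset_cbox by (auto simp: K_def)
  have Q0: "0 \<le> Q x" if "x \<in> K" for x using Q01[of x] Qc that by (cases "x = c") (auto simp: K_def)
  have cont: "continuous_on (box a b) u"
    by (rule continuous_on_subset[OF u box_subset_cbox])
  define U where "U = u -` {\<epsilon><..} \<inter> box a b"
  have "open U"
    using continuous_on_open_vimage[OF open_box, of a b u] cont open_greaterThan[of \<epsilon>]
    unfolding U_def by blast
  moreover have "c \<in> U" "U \<subseteq> K"
    using c \<epsilon> box_subset_cbox by (auto simp: U_def K_def)
  ultimately have U: "open U" "c \<in> U" "U \<subseteq> K" by blast+
  have "\<exists>q<1. 0 \<le> q \<and> (\<forall>x\<in>K - U. Q x \<le> q)"
  proof (cases "K - U = {}")
    case True
    then show ?thesis by (intro exI[of _ 0]) auto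
  next
    case False
    have "compact (K - U)" unfolding K_def by (intro compact_diff U) auto
    moreover have "continuous_on (K - U) Q" using Q by (rule continuous_on_subset) (auto simp: K_def)
    ultimately obtain y where y: "y \<in> K - U" "\<And>x. x \<in> K - U \<Longrightarrow> Q x \<le> Q y"
      using continuous_attains_sup[of "K - U" Q] False by blast
    then have "y \<in> cbox a b" "y \<noteq> c" using U by (auto simp: K_def)
    then show ?thesis using Q01[of y] y by blast
  qed
  then obtain q where q: "q < 1" "0 \<le> q" "\<And>x. x \<in> K - U \<Longrightarrow> Q x \<le> q" by blast
  define s where "s = (1 + q) / 2"
  have s: "q < s" "s < 1" "0 < s" using q by (auto simp: s_def)
  define V where "V = {x \<in> U. s < Q x}"
  have "open V"
  proof -
    have "continuous_on U Q" using Q U(3) continuous_on_subset unfolding K_def by blast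
    then have "open (Q -` {s<..} \<inter> U)"
      using continuous_on_open_vimage[OF U(1), of Q] open_greaterThan[of s] by blast
    moreover have "V = Q -` {s<..} \<inter> U" by (auto simp: V_def)
    ultimately show ?thesis by simp
  qed
  moreover have "c \<in> V" using U s Qc by (auto simp: V_def)
  ultimately obtain a' b' where B: "cbox a' b' \<subseteq> V" "\<forall>i\<in>Basis. a' \<bullet> i < b' \<bullet> i"
    using open_contains_cbox by metis
  define B' where "B' = cbox a' b'"
  have vol: "0 < measure lborel B'" unfolding B'_def by (rule content_pos_lt[OF B(2)])
  have B'K: "B' \<subseteq> K" using B U by (auto simp: B'_def V_def)
  have "compact (u ` K)" unfolding K_def by (intro compact_continuous_image u) auto
  then obtain M where M: "\<And>x. x \<in> K \<Longrightarrow> \<bar>u x\<bar> \<le> M"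
    using compact_imp_bounded[of "u ` K"] by (auto simp: bounded_iff)
  have M0: "0 \<le> M" using M[OF cK] by linarith
  \<comment> \<open>The vanishing integral is compared with a step function: the integrand is at
    least \<epsilon> s^r on the box B', non-negative on the rest of U, and at least -M q^r off U.
    Dividing by s^r and letting r grow forces \<epsilon> times the volume of B' to be at most 0, as
    q < s.\<close>
  have key: "\<epsilon> * s ^ r * measure lborel B' \<le> M * q ^ r * measure lborel K" for r
  proof -
    have "(\<lambda>x. if x \<in> B' then \<epsilon> * s ^ r else 0) integrable_on K"
      unfolding integrable_restrict_Int using B'K
      by (simp add: Int_absorb2 B'_def integrable_continuous)
    moreover have "integral K (\<lambda>x. if x \<in> B' then \<epsilon> * s ^ r else 0) = \<epsilon> * s ^ r * measure lborel B'"
      unfolding integral_restrict_Int using B'K by (simp add: Int_absorb2 B'_def)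
    ultimately have lower: "((\<lambda>x. (if x \<in> B' then \<epsilon> * s ^ r else 0) - M * q ^ r) has_integral
        \<epsilon> * s ^ r * measure lborel B' - M * q ^ r * measure lborel K) K"
      using has_integral_const[of "M * q ^ r" a b]
      by (intro has_integral_diff) (auto simp: has_integral_iff K_def)
    have Qu: "((\<lambda>x. Q x ^ r * u x) has_integral 0) K"
      using zero[of r] unfolding K_def
      by (metis u Q continuous_on_mult continuous_on_power has_integral_integrable_integral integrable_continuous)
    have "\<epsilon> * s ^ r * measure lborel B' - M * q ^ r * measure lborel K \<le> 0"
    proof (rule has_integral_le[OF lower Qu])
      fix x assume x: "x \<in> K"
      consider "x \<in> B'" | "x \<in> U" "x \<notin> B'" | "x \<notin> U" by blast
      then show "(if x \<in> B' then \<epsilon> * s ^ r else 0) - M * q ^ r \<le> Q x ^ r * u x"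
      proof cases
        case 1
        then have "s < Q x" "\<epsilon> < u x" using B by (auto simp: B'_def V_def U_def)
        then have "s ^ r * \<epsilon> \<le> Q x ^ r * u x"
          using s \<epsilon> by (intro mult_mono power_mono) auto
        moreover have "0 \<le> M * q ^ r" using M0 q by simp
        ultimately show ?thesis using 1 by (simp add: mult_ac)
      next
        case 2
        then have "0 \<le> Q x ^ r * u x" using Q0[OF x] \<epsilon> by (auto simp: U_def)
        moreover have "0 \<le> M * q ^ r" using M0 q by simp
        ultimately show ?thesis using 2 by simp
      next
        case 3
        then have "x \<notin> B'" using B by (auto simp: B'_def V_def)
        have "\<bar>Q x ^ r * u x\<bar> \<le> q ^ r * M"
          unfolding abs_mult power_abs using 3 x q Q0[OF x] M0
          by (intro mult_mono power_mono M) auto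
        then show ?thesis using \<open>x \<notin> B'\<close> by (simp add: mult_ac)
      qed
    qed
    then show ?thesis by simp
  qed
  have "(\<lambda>r. M * measure lborel K * (q / s) ^ r) \<longlonglongrightarrow> M * measure lborel K * 0"
    using s q by (intro tendsto_intros LIMSEQ_power_zero) auto
  moreover have "\<epsilon> * measure lborel B' \<le> M * measure lborel K * (q / s) ^ r" for r
    using key[of r] s by (simp add: power_divide field_simps)
  ultimately have "\<epsilon> * measure lborel B' \<le> 0"
    using LIMSEQ_le_const[of _ _ "\<epsilon> * measure lborel B'"] by fastforce
  then show False using \<epsilon> vol by (simp add: mult_le_0_iff)
qed

section \<open>Uniqueness of Fourier coefficients\<close>

lemma fourier_coeff_character_mult:
  "fourier_coeff (\<lambda>x. character k x * f x) m = fourier_coeff f (m - k)"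
  unfolding fourier_coeff_def
  by (rule arg_cong[where f = "integral (cbox 0 1)"])
     (simp add: fun_eq_iff character_add_left[of k "- m", simplified] mult_ac)

lemma fourier_coeff_cmult: "fourier_coeff (\<lambda>x. a * f x) m = a * fourier_coeff f m"
  unfolding fourier_coeff_def mult.assoc by simp

lemma fourier_coeff_add:
  "continuous_on UNIV f \<Longrightarrow> continuous_on UNIV g \<Longrightarrow>
   fourier_coeff (\<lambda>x. f x + g x) m = fourier_coeff f m + fourier_coeff g m"
  unfolding fourier_coeff_def distrib_right
  by (intro integral_add integrable_continuous_UNIV continuous_intros)

lemma fourier_coeff_sum:
  "finite I \<Longrightarrow> (\<And>i. i \<in> I \<Longrightarrow> continuous_on UNIV (f i)) \<Longrightarrow>
   fourier_coeff (\<lambda>x. \<Sum>i\<in>I. f i x) m = (\<Sum>i\<in>I. fourier_coeff (f i) m)"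
  unfolding fourier_coeff_def sum_distrib_right
  by (intro integral_sum integrable_continuous_UNIV continuous_intros) auto

text \<open>Q is the average over j of (1 + cos(2 pi (x_j - c_j))) / 2, a trigonometric polynomial.
  Multiplication by it only combines shifted Fourier coefficients, so every Q^r h keeps vanishing
  coefficients, in particular a vanishing integral. Because c is interior, |x_j - c_j| < 1 on the
  closed cube; hence Q = 1 there only at c, and \<open>peak_function_nonpos\<close> applies.\<close>

lemma fourier_coeff_zero_box:
  fixes h :: "real ^ 'n::finite \<Rightarrow> complex"
  assumes h: "continuous_on UNIV h" and zero: "\<And>m. fourier_coeff h m = 0" and c: "c \<in> box 0 1"
  shows "h c = 0"
proof -
  define Q :: "real ^ 'n \<Rightarrow> real" where
    "Q x = (\<Sum>j\<in>UNIV. 1 + cos (2 * pi * (x $ j - c $ j))) / (2 * real CARD('n))" for x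
  have contQ: "continuous_on S Q" for S
    unfolding Q_def by (intro continuous_intros) auto
  have cos_character: "complex_of_real (cos (2 * pi * (x $ j - c $ j))) =
      (character (- axis j 1) c / 2) * character (axis j 1) x +
      (character (axis j 1) c / 2) * character (- axis j 1) x" for x j
  proof -
    have ch: "character (axis j 1) y = exp (\<i> * of_real (2 * pi * y $ j))"
      "character (- axis j 1) y = exp (- (\<i> * of_real (2 * pi * y $ j)))" for y :: "real ^ 'n"
      by (simp_all add: character_def inner_axis' mult_ac)
    show ?thesis
      unfolding ch cos_of_real[symmetric] cos_exp_eq
      by (simp add: algebra_simps exp_diff exp_add exp_minus divide_simps)
  qed
  have step: "fourier_coeff (\<lambda>x. of_real (Q x) * g x) m = 0"
    if g: "continuous_on UNIV g" and g0: "\<And>m. fourier_coeff g m = 0" for g m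
  proof -
    have eq: "(\<lambda>x. of_real (Q x) * g x) = (\<lambda>x. (1 / (2 * of_nat CARD('n))) *
       (\<Sum>j\<in>UNIV. g x + ((character (- axis j 1) c / 2) * (character (axis j 1) x * g x) +
          (character (axis j 1) c / 2) * (character (- axis j 1) x * g x))))"
      unfolding Q_def of_real_divide of_real_sum of_real_add cos_character
      by (rule ext) (simp add: sum_distrib_left sum_distrib_right sum_divide_distrib,
        rule sum.cong, simp_all add: field_simps)
    have cont: "continuous_on UNIV (\<lambda>x. a * (character k x * g x))" for a k
      by (intro continuous_intros g)
    have "fourier_coeff (\<lambda>x. g x + ((character (- axis j 1) c / 2) * (character (axis j 1) x * g x) +
          (character (axis j 1) c / 2) * (character (- axis j 1) x * g x))) m = 0" for j
      by (subst fourier_coeff_add, intro g, intro continuous_on_add cont, subst fourier_coeff_add,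
          (rule cont)+) (simp only: fourier_coeff_cmult fourier_coeff_character_mult g0 mult_zero_right add_0)
    then show ?thesis
      unfolding eq fourier_coeff_cmult
      by (subst fourier_coeff_sum, simp, intro continuous_on_add cont g, simp only: sum.neutral_const mult_zero_right)
  qed
  have powers: "continuous_on UNIV (\<lambda>x. of_real (Q x) ^ r * h x) \<and>
      (\<forall>m. fourier_coeff (\<lambda>x. of_real (Q x) ^ r * h x) m = 0)" for r
  proof (induction r)
    case 0
    then show ?case using h zero by simp
  next
    case (Suc r)
    then show ?case
      using step[of "\<lambda>x. of_real (Q x) ^ r * h x"]
      by (auto simp: mult.assoc intro!: continuous_intros contQ)
  qed
  \<comment> \<open>A real function with u c = |h c|^2, so the one-sided conclusion u c \<le> 0
    already gives h c = 0.\<close>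
  define u where "u x = Re (cnj (h c) * h x)" for x
  have "u c \<le> 0"
  proof (rule peak_function_nonpos[OF _ contQ c])
    show "continuous_on (cbox 0 1) u"
      unfolding u_def by (intro continuous_intros continuous_on_subset[OF h]) auto
    show "Q c = 1" by (simp add: Q_def)
    show "0 \<le> Q x \<and> Q x < 1" if x: "x \<in> cbox 0 1" "x \<noteq> c" for x
    proof
      show "0 \<le> Q x"
        unfolding Q_def using cos_ge_minus_one
        by (intro divide_nonneg_nonneg sum_nonneg)
           (auto simp: add.commute[of 1] neg_le_iff_le simp flip: diff_le_eq)
      obtain j where j: "x $ j \<noteq> c $ j" using x by (auto simp: vec_eq_iff)
      have "\<bar>x $ j - c $ j\<bar> < 1"
        using x(1) c by (simp add: mem_box_cart) (smt (verit))
      have "cos (2 * pi * (x $ j - c $ j)) \<noteq> 1"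
      proof
        assume "cos (2 * pi * (x $ j - c $ j)) = 1"
        then obtain i :: int where "2 * pi * (x $ j - c $ j) = of_int i * 2 * pi"
          unfolding cos_one_2pi_int by blast
        then have "x $ j - c $ j = of_int i" by simp
        moreover from this have "i = 0" using \<open>\<bar>x $ j - c $ j\<bar> < 1\<close> by simp
        ultimately show False using j by simp
      qed
      then have "cos (2 * pi * (x $ j - c $ j)) < 1"
        using cos_le_one less_le by blast
      then have "(\<Sum>j\<in>UNIV. 1 + cos (2 * pi * (x $ j - c $ j))) < (\<Sum>j\<in>(UNIV::'n set). 2)"
        by (intro sum_strict_mono_ex1) (auto intro: exI[of _ j])
      then show "Q x < 1" by (simp add: Q_def)
    qed
    show "integral (cbox 0 1) (\<lambda>x. Q x ^ r * u x) = 0" for r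
    proof -
      have "integral (cbox 0 1) (\<lambda>x. cnj (h c) * (of_real (Q x) ^ r * h x)) = 0"
        using powers[of r] by (auto simp: fourier_coeff_def dest: spec[of _ 0])
      moreover have "(\<lambda>x. cnj (h c) * (of_real (Q x) ^ r * h x)) integrable_on cbox 0 1"
        by (intro integrable_continuous_UNIV continuous_intros contQ h)
      ultimately have "((\<lambda>x. cnj (h c) * (of_real (Q x) ^ r * h x)) has_integral 0) (cbox 0 1)"
        by (simp add: has_integral_iff)
      from has_integral_linear[OF this bounded_linear_Re]
      have "((\<lambda>x. Re (cnj (h c) * (of_real (Q x) ^ r * h x))) has_integral 0) (cbox 0 1)"
        by (simp only: o_def zero_complex.sel)
      moreover have "Re (cnj (h c) * (of_real (Q x) ^ r * h x)) = Q x ^ r * u x" for x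
        unfolding u_def by (simp add: algebra_simps flip: of_real_power)
      ultimately show ?thesis by (simp add: integral_unique)
    qed
  qed
  then have "(cmod (h c))\<^sup>2 \<le> 0"
    unfolding cmod_power2 by (simp add: u_def power2_eq_square)
  then show ?thesis by simp
qed

text \<open>The difference of f and its Fourier series has vanishing coefficients, hence is 0 in the
  open cube, by continuity on the closed cube, and by periodicity everywhere.\<close>

lemma fourier_inversion:
  fixes f :: "real ^ 'n::finite \<Rightarrow> complex"
  assumes f: "smooth_on_torus f"
  shows "trig (fourier_coeff f) = f"
proof
  fix x :: "real ^ 'n"
  note c = fourier_coeff_rapidly_decreasing[OF f]
  define h where "h x = f x + (- 1) * trig (fourier_coeff f) x" for x
  note cont = smooth_on_torus_continuous[OF f] continuous_on_trig[OF c]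
  have h: "continuous_on UNIV h" unfolding h_def by (intro continuous_intros cont)
  have "fourier_coeff h m = 0" for m
    unfolding h_def using cont c
    by (subst fourier_coeff_add)
       (auto simp: fourier_coeff_trig fourier_coeff_cmult[of "-1", simplified] intro!: continuous_intros)
  then have zero: "h y = 0" if "y \<in> box 0 1" for y
    using fourier_coeff_zero_box[OF h] that by blast
  define m :: "int ^ 'n" where "m = (\<chi> j. \<lfloor>x $ j\<rfloor>)"
  have "(1/2) *\<^sub>R 1 \<in> box 0 (1 :: real ^ 'n)" by (simp add: mem_box_cart)
  then have "closure (box 0 (1 :: real ^ 'n)) = cbox 0 1" by (intro closure_box) blast
  moreover have "x - of_lattice m \<in> cbox 0 1"
    by (auto simp: m_def of_lattice_def mem_box_cart, linarith)
  ultimately have "h (x - of_lattice m) = 0"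
    using continuous_constant_on_closure[of "box 0 1" h 0] zero continuous_on_subset[OF h] by auto
  then have "f (x - of_lattice m) = trig (fourier_coeff f) (x - of_lattice m)"
    by (simp add: h_def)
  moreover have "f (x - of_lattice m + of_lattice m) = f (x - of_lattice m)"
    using f unfolding smooth_on_torus_def by blast
  moreover have "trig (fourier_coeff f) (x - of_lattice m + of_lattice m) = trig (fourier_coeff f) (x - of_lattice m)"
    by (rule trig_periodic)
  ultimately show "trig (fourier_coeff f) x = f x" by simp
qed


subsection \<open>Multi-indices and difference operators\<close>

lemma mi_size_0 [simp]: "mi_size 0 = 0"
  by (simp add: mi_size_def)

lemma mi_size_add: "mi_size (\<alpha> + \<beta>) = mi_size \<alpha> + mi_size \<beta>"
  by (simp add: mi_size_def sum.distrib)

lemma mi_size_axis [simp]: "mi_size (axis j p) = p"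
  by (simp add: mi_size_def axis_def)

lemma mi_size_eq_0_iff: "mi_size \<alpha> = 0 \<longleftrightarrow> \<alpha> = 0"
  by (auto simp: mi_size_def vec_eq_iff)

lemma mi_remove_axis:
  fixes \<alpha> :: "nat ^ 'n::finite"
  assumes "\<alpha> $ j \<noteq> 0"
  obtains \<beta> where "\<alpha> = \<beta> + axis j 1"
proof
  show "\<alpha> = (\<chi> i. if i = j then \<alpha> $ i - 1 else \<alpha> $ i) + axis j 1"
    using assms by (auto simp: vec_eq_iff axis_def)
qed

lemma mi_induct [case_names zero add_axis]:
  fixes \<alpha> :: "nat ^ 'n::finite"
  assumes zero: "P 0" and step: "\<And>\<alpha> j. P \<alpha> \<Longrightarrow> P (\<alpha> + axis j 1)"
  shows "P \<alpha>"
proof (induction "mi_size \<alpha>" arbitrary: \<alpha>)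
  case 0
  then show ?case using zero by (simp add: mi_size_eq_0_iff)
next
  case (Suc n)
  then have "\<alpha> \<noteq> 0" by auto
  then obtain j where "\<alpha> $ j \<noteq> 0" by (auto simp: vec_eq_iff)
  then obtain \<beta> where \<beta>: "\<alpha> = \<beta> + axis j 1" by (rule mi_remove_axis)
  then have "n = mi_size \<beta>" using Suc.hyps(2) by (simp add: mi_size_add)
  then show ?case unfolding \<beta> by (intro step Suc.hyps(1))
qed

text \<open>The predicate ranges over operators, so that linearity, conjugation, shifts and
  preservation of decay are each checked on a single difference, without regard to the order in
  which the coordinates are composed.\<close>

lemma mi_diff_op_induct [case_names id diff]:
  assumes id: "P (\<lambda>\<tau>. \<tau>)" and diff: "\<And>j A. P A \<Longrightarrow> P (\<lambda>\<tau>. diff_op j (A \<tau>))"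
  shows "P (mi_diff_op \<alpha>)"
proof -
  have pow: "P (\<lambda>\<tau>. (diff_op j ^^ n) (A \<tau>))" if "P A" for j n A
    using that by (induction n) (auto intro: diff)
  have "P (\<lambda>\<tau>. foldr (\<lambda>j. diff_op j ^^ (\<alpha> $ j)) xs \<tau>)" for xs
    by (induction xs) (auto intro: id pow)
  then show ?thesis by (simp add: mi_diff_op_def[abs_def])
qed

lemma diff_op_commute: "diff_op i (diff_op j \<tau>) = diff_op j (diff_op i \<tau>)"
  by (rule ext) (simp add: diff_op_def algebra_simps)

lemma diff_op_pow_commute: "(diff_op i ^^ n) (diff_op j \<tau>) = diff_op j ((diff_op i ^^ n) \<tau>)"
  by (induction n) (simp_all add: diff_op_commute)

lemma mi_diff_op_0 [simp]: "mi_diff_op 0 \<tau> = \<tau>"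
proof -
  have "foldr (\<lambda>j. diff_op j ^^ ((0 :: nat ^ 'a::{finite,linorder}) $ j)) xs \<tau> = \<tau>" for xs
    by (induction xs) auto
  then show ?thesis by (simp add: mi_diff_op_def)
qed

lemma mi_diff_op_add_axis: "mi_diff_op (\<alpha> + axis j 1) \<tau> = diff_op j (mi_diff_op \<alpha> \<tau>)"
proof -
  \<comment> \<open>Generalised to duplicate-free lists: j then occurs at most once, and its
    additional difference commutes past the operators in front of it.\<close>
  have "foldr (\<lambda>i. diff_op i ^^ ((\<alpha> + axis j 1) $ i)) xs \<tau> =
      (if j \<in> set xs then diff_op j (foldr (\<lambda>i. diff_op i ^^ (\<alpha> $ i)) xs \<tau>)
       else foldr (\<lambda>i. diff_op i ^^ (\<alpha> $ i)) xs \<tau>)" if "distinct xs" for xs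
    using that by (induction xs) (auto simp: axis_def diff_op_pow_commute)
  then show ?thesis by (simp add: mi_diff_op_def)
qed

lemma mi_diff_op_mi_diff_op: "mi_diff_op \<alpha> (mi_diff_op \<beta> \<tau>) = mi_diff_op (\<alpha> + \<beta>) \<tau>"
proof (induction \<alpha> rule: mi_induct)
  case (add_axis \<alpha> j)
  have "\<alpha> + axis j 1 + \<beta> = (\<alpha> + \<beta>) + axis j 1" by (simp add: ac_simps)
  then show ?case using add_axis by (simp only: mi_diff_op_add_axis)
qed simp

lemma mi_diff_op_commute: "mi_diff_op \<alpha> (mi_diff_op \<beta> \<tau>) = mi_diff_op \<beta> (mi_diff_op \<alpha> \<tau>)"
  by (simp add: mi_diff_op_mi_diff_op add.commute)

lemma mi_diff_op_diff_op: "mi_diff_op \<alpha> (diff_op j \<tau>) = mi_diff_op (\<alpha> + axis j 1) \<tau>"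
  using mi_diff_op_commute[of \<alpha> "axis j 1" \<tau>] mi_diff_op_add_axis[of 0 j]
  by (simp add: mi_diff_op_add_axis del: One_nat_def)

lemma mi_diff_op_cmult: "mi_diff_op \<alpha> (\<lambda>l. c * \<tau> l) k = c * mi_diff_op \<alpha> \<tau> k"
  by (induction arbitrary: k rule: mi_diff_op_induct) (auto simp: diff_op_def algebra_simps)

lemma mi_diff_op_diff_fun: "mi_diff_op \<alpha> (\<lambda>l. \<tau> l - \<tau>' l) k = mi_diff_op \<alpha> \<tau> k - mi_diff_op \<alpha> \<tau>' k"
  by (induction arbitrary: k rule: mi_diff_op_induct) (auto simp: diff_op_def algebra_simps)

lemma mi_diff_op_sum_fun:
  "mi_diff_op \<alpha> (\<lambda>l. \<Sum>i\<in>I. \<tau> i l) k = (\<Sum>i\<in>I. mi_diff_op \<alpha> (\<tau> i) k)"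
  by (induction arbitrary: k rule: mi_diff_op_induct) (auto simp: diff_op_def sum_subtractf)

lemma mi_diff_op_cnj: "mi_diff_op \<alpha> (\<lambda>l. cnj (\<tau> l)) k = cnj (mi_diff_op \<alpha> \<tau> k)"
  by (induction arbitrary: k rule: mi_diff_op_induct) (auto simp: diff_op_def)

lemma mi_diff_op_shift: "mi_diff_op \<alpha> (\<lambda>l. \<tau> (l + m)) k = mi_diff_op \<alpha> \<tau> (k + m)"
proof (induction arbitrary: k rule: mi_diff_op_induct)
  case (diff j A)
  then show ?case
    using diff[of "k + axis j 1"] by (simp add: diff_op_def ac_simps)
qed simp

lemma mi_diff_op_trig:
  assumes b: "\<And>k. b k \<in> rapidly_decreasing"
  shows rapidly_decreasing_mi_diff_op: "(\<lambda>m. mi_diff_op \<alpha> (\<lambda>l. b l m) k) \<in> rapidly_decreasing"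
    and "mi_diff_op \<alpha> (\<lambda>l. trig (b l) x) k = trig (\<lambda>m. mi_diff_op \<alpha> (\<lambda>l. b l m) k) x"
proof -
  \<comment> \<open>Both claims go through one induction, because \<open>trig_diff\<close> requires
    decay of both series.\<close>
  have "(\<lambda>m. mi_diff_op \<alpha> (\<lambda>l. b l m) k) \<in> rapidly_decreasing \<and>
      mi_diff_op \<alpha> (\<lambda>l. trig (b l) x) k = trig (\<lambda>m. mi_diff_op \<alpha> (\<lambda>l. b l m) k) x"
  proof (induction arbitrary: k rule: mi_diff_op_induct)
    case id
    then show ?case using b by simp
  next
    case (diff j A)
    then show ?case by (simp add: diff_op_def rapidly_decreasing_diff trig_diff)
  qed
  then show "(\<lambda>m. mi_diff_op \<alpha> (\<lambda>l. b l m) k) \<in> rapidly_decreasing"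
    "mi_diff_op \<alpha> (\<lambda>l. trig (b l) x) k = trig (\<lambda>m. mi_diff_op \<alpha> (\<lambda>l. b l m) k) x"
    by blast+
qed


subsection \<open>Falling factorials as Fourier multipliers\<close>

definition falling :: "nat ^ 'n::finite \<Rightarrow> int ^ 'n \<Rightarrow> complex" where
  "falling \<alpha> m = (\<Prod>j\<in>UNIV. \<Prod>i<\<alpha> $ j. of_int (m $ j) - of_nat i)"

lemma fall_deriv_trig:
  assumes c: "c \<in> rapidly_decreasing"
  shows "(\<lambda>m. (\<Prod>i<l. of_int (m $ j) - of_nat i) * c m) \<in> rapidly_decreasing \<and>
    fall_deriv j l (trig c) = trig (\<lambda>m. (\<Prod>i<l. of_int (m $ j) - of_nat i) * c m)"
proof (induction l)
  case 0
  then show ?case using c by simp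
next
  case (Suc l)
  define d where "d m = (\<Prod>i<l. of_int (m $ j) - of_nat i) * c m" for m
  have d: "d \<in> rapidly_decreasing" using Suc by (simp add: d_def[abs_def])
  have eq: "(\<Prod>i<Suc l. of_int (m $ j) - of_nat i) * c m = of_int (m $ j) * d m - of_nat l * d m" for m
    by (simp add: d_def algebra_simps)
  have "fall_deriv j (Suc l) (trig c) x = trig (\<lambda>m. of_int (m $ j) * d m - of_nat l * d m) x" for x
  proof -
    have "fall_deriv j (Suc l) (trig c) x = trig (\<lambda>m. of_int (m $ j) * d m) x - of_nat l * trig d x"
      using Suc by (simp add: d_def[abs_def, symmetric] partial_deriv_trig[OF d] trig_cmult)
    also have "\<dots> = trig (\<lambda>m. of_int (m $ j) * d m - of_nat l * d m) x"
      by (simp add: trig_diff trig_cmult d rapidly_decreasing_coord rapidly_decreasing_cmult)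
    finally show ?thesis .
  qed
  moreover have "(\<lambda>m. of_int (m $ j) * d m - of_nat l * d m) \<in> rapidly_decreasing"
    by (intro rapidly_decreasing_diff rapidly_decreasing_coord rapidly_decreasing_cmult d)
  ultimately show ?case unfolding eq by blast
qed

lemma mi_fall_deriv_trig:
  fixes \<beta> :: "nat ^ 'n::{finite,linorder}"
  assumes c: "c \<in> rapidly_decreasing"
  shows rapidly_decreasing_falling: "(\<lambda>m. falling \<beta> m * c m) \<in> rapidly_decreasing"
    and "mi_fall_deriv \<beta> (trig c) = trig (\<lambda>m. falling \<beta> m * c m)"
proof -
  define p where "p j m = (\<Prod>i<\<beta> $ j. complex_of_int (m $ j) - of_nat i)" for j and m :: "int ^ 'n::{finite,linorder}"
  have "(\<lambda>m. (\<Prod>j\<in>set xs. p j m) * c m) \<in> rapidly_decreasing \<and>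
      foldr (\<lambda>j. fall_deriv j (\<beta> $ j)) xs (trig c) = trig (\<lambda>m. (\<Prod>j\<in>set xs. p j m) * c m)"
    if "distinct xs" for xs
    using that
  proof (induction xs)
    case Nil
    then show ?case using c by simp
  next
    case (Cons j xs)
    then show ?case
      using fall_deriv_trig[where c = "\<lambda>m. (\<Prod>j\<in>set xs. p j m) * c m" and l = "\<beta> $ j" and j = j]
      by (simp add: p_def mult.assoc)
  qed
  from this[of "sorted_list_of_set UNIV"]
  show "(\<lambda>m. falling \<beta> m * c m) \<in> rapidly_decreasing"
    "mi_fall_deriv \<beta> (trig c) = trig (\<lambda>m. falling \<beta> m * c m)"
    by (simp_all add: mi_fall_deriv_def falling_def p_def)
qed

lemma falling_0 [simp]: "falling 0 m = 1"
  by (simp add: falling_def)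

lemma falling_split:
  "falling \<alpha> m = (\<Prod>i<\<alpha> $ j. of_int (m $ j) - of_nat i) *
     (\<Prod>j'\<in>UNIV - {j}. \<Prod>i<\<alpha> $ j'. of_int (m $ j') - of_nat i)"
  unfolding falling_def by (subst prod.remove[of _ j]) auto

lemma falling_axis: "falling (axis j p) m = (\<Prod>i<p. of_int (m $ j) - of_nat i)"
  unfolding falling_split[of _ _ j] by (simp add: axis_def)

lemma falling_add_axis: "falling (\<alpha> + axis j 1) m = (of_int (m $ j) - of_nat (\<alpha> $ j)) * falling \<alpha> m"
  unfolding falling_split[of _ _ j] by (simp add: axis_def mult_ac)

lemma falling_at_0: "\<alpha> \<noteq> 0 \<Longrightarrow> falling \<alpha> 0 = 0"
  unfolding falling_def by (auto simp: vec_eq_iff intro!: prod_zero)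

text \<open>The discrete power rule. With z = m_j and l = \<alpha>_j, the two products in coordinate
  j share z (z - 1) ... (z - l + 1); the remaining factors are z + 1 and z - l, which differ by l +
  1.\<close>

lemma diff_op_falling_add_axis:
  fixes \<alpha> :: "nat ^ 'n::finite"
  shows "diff_op j (falling (\<alpha> + axis j 1)) m = of_nat (Suc (\<alpha> $ j)) * falling \<alpha> m"
proof -
  have "(\<Prod>i<Suc l. (z + 1) - of_nat i) - (\<Prod>i<Suc l. z - of_nat i) =
      of_nat (Suc l) * (\<Prod>i<l. z - of_nat i)" for z :: complex and l :: nat
    by (subst prod.lessThan_Suc_shift) (simp add: algebra_simps)
  note newton = this[of "of_int (m $ j)" "\<alpha> $ j"]
  define R where "R = (\<Prod>j'\<in>UNIV - {j}. \<Prod>i<\<alpha> $ j'. complex_of_int (m $ j') - of_nat i)"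
  have "falling (\<alpha> + axis j 1) (m + axis j 1) =
      (\<Prod>i<Suc (\<alpha> $ j). (of_int (m $ j) + 1) - of_nat i) * R"
    "falling (\<alpha> + axis j 1) m = (\<Prod>i<Suc (\<alpha> $ j). of_int (m $ j) - of_nat i) * R"
    "falling \<alpha> m = (\<Prod>i<\<alpha> $ j. of_int (m $ j) - of_nat i) * R"
    unfolding falling_split[of _ _ j] R_def
    by (simp_all add: axis_def cong: prod.cong_simp)
  then show ?thesis
    using newton unfolding diff_op_def by (simp only: left_diff_distrib[symmetric] mult.assoc)
qed

lemma diff_op_falling_neutral: "\<alpha> $ j = 0 \<Longrightarrow> diff_op j (falling \<alpha>) m = 0"
  unfolding diff_op_def falling_split[of _ _ j] by (simp add: axis_def cong: prod.cong_simp)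

lemma mi_fact_add_axis: "mi_fact (\<alpha> + axis j 1) = Suc (\<alpha> $ j) * mi_fact \<alpha>"
  unfolding mi_fact_def
  by (subst (1 2) prod.remove[of _ j]) (auto simp: axis_def algebra_simps cong: prod.cong_simp)


subsection \<open>Newton's formula on the lattice\<close>

text \<open>The remainder is a function of the increment m with \<open>\<tau>\<close> held fixed, so
  that differences in m can be taken. Later \<open>\<tau>\<close> is
  \<open>\<lambda>l. b l m\<close>, with the frequency itself as the increment.\<close>

definition newton_rem ::
  "nat \<Rightarrow> (int ^ 'n::{finite,linorder} \<Rightarrow> complex) \<Rightarrow> int ^ 'n::{finite,linorder} \<Rightarrow>
   int ^ 'n::{finite,linorder} \<Rightarrow> complex" where
  "newton_rem N \<tau> k m = \<tau> (k + m) -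
     (\<Sum>\<alpha> | mi_size \<alpha> < N. 1 / of_nat (mi_fact \<alpha>) * (falling \<alpha> m * mi_diff_op \<alpha> \<tau> k))"

lemma newton_rem_0 [simp]: "newton_rem 0 \<tau> k m = \<tau> (k + m)"
  by (simp add: newton_rem_def)

lemma newton_rem_cmult: "newton_rem N (\<lambda>l. c * \<tau> l) k m = c * newton_rem N \<tau> k m"
  by (simp add: newton_rem_def mi_diff_op_cmult right_diff_distrib sum_distrib_left mult_ac)

lemma mi_diff_op_newton_rem:
  "mi_diff_op \<beta> (\<lambda>l. newton_rem N \<tau> l m) k = newton_rem N (mi_diff_op \<beta> \<tau>) k m"
  unfolding newton_rem_def mi_diff_op_diff_fun mi_diff_op_sum_fun mi_diff_op_cmult
    mi_diff_op_shift mi_diff_op_commute[of \<beta>] ..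

lemma newton_rem_Suc_at_0: "newton_rem (Suc N) \<tau> k 0 = 0"
proof -
  have "(\<Sum>\<alpha> | mi_size \<alpha> < Suc N. 1 / of_nat (mi_fact \<alpha>) * (falling \<alpha> 0 * mi_diff_op \<alpha> \<tau> k)) =
      (\<Sum>\<alpha>\<in>{0}. 1 / of_nat (mi_fact \<alpha>) * (falling \<alpha> 0 * mi_diff_op \<alpha> \<tau> k))"
    by (rule sum.mono_neutral_right) (auto simp: finite_mi_size_less falling_at_0)
  then show ?thesis by (simp add: newton_rem_def mi_fact_def)
qed

text \<open>By the power rule a difference in m lowers the order of each Newton polynomial by one,
  or kills it when \<alpha>_j = 0; the factor \<alpha>_j + 1 cancels against the factorial, and the
  index shift puts a difference on \<tau>. This recursion takes the place of an explicit remainder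
  formula.\<close>

lemma diff_op_newton_rem_Suc:
  "diff_op j (newton_rem (Suc N) \<tau> k) m = newton_rem N (diff_op j \<tau>) k m"
proof -
  let ?f = "\<lambda>\<alpha>. 1 / of_nat (mi_fact \<alpha>) * (diff_op j (falling \<alpha>) m * mi_diff_op \<alpha> \<tau> k)"
  have "(\<Sum>\<alpha> | mi_size \<alpha> < Suc N. ?f \<alpha>) = (\<Sum>\<alpha> \<in> (\<lambda>\<alpha>. \<alpha> + axis j 1) ` {\<alpha>. mi_size \<alpha> < N}. ?f \<alpha>)"
  proof (rule sum.mono_neutral_right)
    show "\<forall>\<alpha>\<in>{\<alpha>. mi_size \<alpha> < Suc N} - (\<lambda>\<alpha>. \<alpha> + axis j 1) ` {\<alpha>. mi_size \<alpha> < N}. ?f \<alpha> = 0"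
    proof
      fix \<alpha> assume \<alpha>: "\<alpha> \<in> {\<alpha>. mi_size \<alpha> < Suc N} - (\<lambda>\<alpha>. \<alpha> + axis j 1) ` {\<alpha>. mi_size \<alpha> < N}"
      have "\<alpha> $ j = 0"
      proof (rule ccontr)
        assume "\<alpha> $ j \<noteq> 0"
        then obtain \<beta> where "\<alpha> = \<beta> + axis j 1" by (rule mi_remove_axis)
        then show False using \<alpha> by (auto simp: mi_size_add)
      qed
      then show "?f \<alpha> = 0" by (simp add: diff_op_falling_neutral)
    qed
  qed (auto simp: finite_mi_size_less mi_size_add)
  also have "\<dots> = (\<Sum>\<alpha> | mi_size \<alpha> < N. ?f (\<alpha> + axis j 1))"
    by (subst sum.reindex) (auto simp: inj_on_def)
  also have "\<dots> = (\<Sum>\<alpha> | mi_size \<alpha> < N. 1 / of_nat (mi_fact \<alpha>) * (falling \<alpha> m * mi_diff_op \<alpha> (diff_op j \<tau>) k))"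
  proof (rule sum.cong)
    fix \<alpha> :: "nat ^ 'a::{finite,linorder}"
    have "complex_of_nat (Suc (\<alpha> $ j)) \<noteq> 0" by (rule of_nat_neq_0)
    then show "?f (\<alpha> + axis j 1) = 1 / of_nat (mi_fact \<alpha>) * (falling \<alpha> m * mi_diff_op \<alpha> (diff_op j \<tau>) k)"
      unfolding mi_fact_add_axis diff_op_falling_add_axis mi_diff_op_diff_op of_nat_mult
      by (simp del: of_nat_Suc)
  qed simp
  finally have "(\<Sum>\<alpha> | mi_size \<alpha> < Suc N. ?f \<alpha>) =
     (\<Sum>\<alpha> | mi_size \<alpha> < N. 1 / of_nat (mi_fact \<alpha>) * (falling \<alpha> m * mi_diff_op \<alpha> (diff_op j \<tau>) k))" .
  moreover have "diff_op j (newton_rem (Suc N) \<tau> k) m = diff_op j \<tau> (k + m) - (\<Sum>\<alpha> | mi_size \<alpha> < Suc N. ?f \<alpha>)"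
    unfolding newton_rem_def diff_op_def
    by (simp add: sum_subtractf right_diff_distrib left_diff_distrib ac_simps)
  ultimately show ?thesis by (simp add: newton_rem_def)
qed

section \<open>Paths of unit steps in the lattice and the size of the Newton remainder\<close>

lemma l1_size_eq_0_iff: "l1_size m = 0 \<longleftrightarrow> m = 0"
  by (auto simp: l1_size_def vec_eq_iff)

lemma l1_size_split: "l1_size m = nat \<bar>m $ j\<bar> + (\<Sum>i\<in>UNIV - {j}. nat \<bar>m $ i\<bar>)"
  unfolding l1_size_def by (rule sum.remove) auto

lemma l1_size_diff_axis: "0 < m $ j \<Longrightarrow> Suc (l1_size (m - axis j 1)) = l1_size m"
  unfolding l1_size_split[of _ j] by (simp add: axis_def cong: sum.cong_simp)

lemma l1_size_add_axis: "m $ j < 0 \<Longrightarrow> Suc (l1_size (m + axis j 1)) = l1_size m"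
  unfolding l1_size_split[of _ j] by (simp add: axis_def cong: sum.cong_simp)

text \<open>Each step of a path from m to 0 decreases one |m_j| and changes g by one difference. It
  is taken at the smaller point if m_j > 0 and at m itself if m_j < 0, so every point used lies in
  the ball of radius L. Asking for the bound on the whole ball keeps the lemma usable inside the
  induction on the length of the expansion.\<close>

lemma norm_le_lattice_path:
  assumes "g 0 = 0" and step: "\<And>j \<theta>. l1_size \<theta> \<le> L \<Longrightarrow> cmod (diff_op j g \<theta>) \<le> B"
    and "l1_size m \<le> L"
  shows "cmod (g m) \<le> real (l1_size m) * B"
  using assms(3)
proof (induction "l1_size m" arbitrary: m)
  case 0
  then show ?case using assms(1) l1_size_eq_0_iff[of m] by simp
next
  case (Suc n)
  then have "m \<noteq> 0" using l1_size_eq_0_iff[of m] by auto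
  then obtain j where "m $ j \<noteq> 0" by (auto simp: vec_eq_iff)
  then consider "0 < m $ j" | "m $ j < 0" by linarith
  then show ?case
  proof cases
    case 1
    have l: "l1_size (m - axis j 1) = n" using l1_size_diff_axis[OF 1] Suc.hyps by simp
    have "g m = g (m - axis j 1) + diff_op j g (m - axis j 1)" by (simp add: diff_op_def)
    then have "cmod (g m) \<le> cmod (g (m - axis j 1)) + cmod (diff_op j g (m - axis j 1))"
      by (metis norm_triangle_ineq)
    also have "\<dots> \<le> real n * B + B"
      using Suc l by (intro add_mono step) auto
    finally show ?thesis using Suc.hyps(2) by (simp add: algebra_simps flip: Suc.hyps(2))
  next
    case 2
    have l: "l1_size (m + axis j 1) = n" using l1_size_add_axis[OF 2] Suc.hyps by simp
    have "g m = g (m + axis j 1) - diff_op j g m" by (simp add: diff_op_def)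
    then have "cmod (g m) \<le> cmod (g (m + axis j 1)) + cmod (diff_op j g m)"
      by (metis norm_triangle_ineq4)
    also have "\<dots> \<le> real n * B + B"
      using Suc l by (intro add_mono step) auto
    finally show ?thesis using Suc.hyps(2) by (simp add: algebra_simps flip: Suc.hyps(2))
  qed
qed

text \<open>Differences in m of a remainder are shorter remainders of differences of \<tau>, to
  which the induction hypothesis applies. A remainder of positive length vanishes at m = 0, so
  summing along a path recovers it at the cost of a factor at most L.\<close>

lemma norm_newton_rem_le:
  fixes \<tau> :: "int ^ 'n::{finite,linorder} \<Rightarrow> complex"
  assumes "\<And>\<alpha> \<theta>. mi_size \<alpha> = N \<Longrightarrow> l1_size \<theta> \<le> L \<Longrightarrow> cmod (mi_diff_op \<alpha> \<tau> (k + \<theta>)) \<le> B"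
    and "l1_size m \<le> L"
  shows "cmod (newton_rem N \<tau> k m) \<le> real L ^ N * B"
  using assms
proof (induction N arbitrary: \<tau> m)
  case 0
  then show ?case using 0(1)[of 0 m] by simp
next
  case (Suc N)
  \<comment> \<open>\<open>axis undefined (Suc N)\<close> is merely some multi-index of size N + 1,
    and 0 some point of the ball.\<close>
  have B0: "0 \<le> B"
    using Suc.prems(1)[of "axis undefined (Suc N)" 0] order.trans[OF norm_ge_zero] by (simp add: l1_size_def)
  have "cmod (newton_rem (Suc N) \<tau> k m) \<le> real (l1_size m) * (real L ^ N * B)"
  proof (rule norm_le_lattice_path[where g = "newton_rem (Suc N) \<tau> k", OF newton_rem_Suc_at_0 _ Suc.prems(2)])
    fix j :: 'n and \<theta> :: "int ^ 'n::{finite,linorder}" assume "l1_size \<theta> \<le> L"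
    then show "cmod (diff_op j (newton_rem (Suc N) \<tau> k) \<theta>) \<le> real L ^ N * B"
      unfolding diff_op_newton_rem_Suc
      by (intro Suc.IH) (auto simp: mi_diff_op_diff_op mi_size_add intro!: Suc.prems(1))
  qed
  also have "\<dots> \<le> real L * (real L ^ N * B)"
    using Suc.prems(2) B0 by (intro mult_right_mono) auto
  finally show ?case by (simp add: mult_ac)
qed

text \<open>
  Polynomial multipliers of degree at most \<open>d\<close>. The estimates of a symbol class are stated for
  falling factorials only, but conjugation and composition of the operators \<open>D\<^bsup>(\<beta>)\<^esup>\<close> lead out of
  this family.
\<close>

inductive fall_poly :: "nat \<Rightarrow> (int ^ 'n::finite \<Rightarrow> complex) \<Rightarrow> bool" where
  fall_poly_falling: "mi_size \<gamma> \<le> d \<Longrightarrow> fall_poly d (falling \<gamma>)"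
| fall_poly_add: "fall_poly d p \<Longrightarrow> fall_poly d q \<Longrightarrow> fall_poly d (\<lambda>m. p m + q m)"
| fall_poly_cmult: "fall_poly d p \<Longrightarrow> fall_poly d (\<lambda>m. c * p m)"

lemma fall_poly_mono: "fall_poly d p \<Longrightarrow> d \<le> e \<Longrightarrow> fall_poly e p"
  by (induction rule: fall_poly.induct) (auto intro: fall_poly.intros)

text \<open>Writing m_j as (m_j - \<gamma>_j) + \<gamma>_j turns the product with a falling
  factorial into a longer one plus a multiple of the old one.\<close>

lemma fall_poly_coord:
  assumes "fall_poly d p"
  shows "fall_poly (Suc d) (\<lambda>m. of_int (m $ j) * p m)"
  using assms
proof (induction rule: fall_poly.induct)
  case (fall_poly_falling \<gamma> d)
  have "(\<lambda>m. of_int (m $ j) * falling \<gamma> m) =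
      (\<lambda>m. falling (\<gamma> + axis j 1) m + of_nat (\<gamma> $ j) * falling \<gamma> m)"
    by (rule ext) (simp only: falling_add_axis, simp add: algebra_simps)
  moreover have "fall_poly (Suc d) (falling (\<gamma> + axis j 1))" "fall_poly (Suc d) (falling \<gamma>)"
    using fall_poly_falling by (auto intro!: fall_poly.fall_poly_falling simp: mi_size_add)
  ultimately show ?case by (auto intro: fall_poly_add fall_poly_cmult)
next
  case (fall_poly_add d p q)
  then show ?case using fall_poly.fall_poly_add by (fastforce simp: distrib_left)
next
  case (fall_poly_cmult d p c)
  then show ?case using fall_poly.fall_poly_cmult[of "Suc d" _ c] by (simp add: mult.left_commute)
qed

lemma fall_poly_mult_falling:
  assumes "fall_poly d p"
  shows "fall_poly (mi_size \<alpha> + d) (\<lambda>m. falling \<alpha> m * p m)"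
proof (induction \<alpha> rule: mi_induct)
  case zero
  then show ?case using assms by simp
next
  case (add_axis \<alpha> j)
  have "fall_poly (Suc (mi_size \<alpha> + d)) (\<lambda>m. of_int (m $ j) * (falling \<alpha> m * p m) +
      - of_nat (\<alpha> $ j) * (falling \<alpha> m * p m))"
    by (intro fall_poly_add fall_poly_coord fall_poly_cmult fall_poly_mono[OF add_axis] add_axis) simp
  moreover have "(\<lambda>m. falling (\<alpha> + axis j 1) m * p m) = (\<lambda>m. of_int (m $ j) * (falling \<alpha> m * p m) +
      - of_nat (\<alpha> $ j) * (falling \<alpha> m * p m))"
    by (rule ext) (simp only: falling_add_axis, simp add: algebra_simps)
  moreover have "mi_size (\<alpha> + axis j 1) + d = Suc (mi_size \<alpha> + d)" by (simp add: mi_size_add)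
  ultimately show ?case by (simp only:)
qed

lemma fall_poly_mult: "fall_poly d p \<Longrightarrow> fall_poly e q \<Longrightarrow> fall_poly (d + e) (\<lambda>m. p m * q m)"
proof (induction rule: fall_poly.induct)
  case (fall_poly_falling \<gamma> d)
  then show ?case by (intro fall_poly_mono[OF fall_poly_mult_falling]) auto
next
  case (fall_poly_add d p p')
  then show ?case using fall_poly.fall_poly_add[of "d + e"] by (simp add: distrib_right)
next
  case (fall_poly_cmult d p c)
  then show ?case using fall_poly.fall_poly_cmult[of "d + e" _ c] by (simp add: mult.assoc)
qed

text \<open>The reflection accompanies conjugation because \<open>cnj\<close> exchanges the
  frequencies m and -m. Each new factor becomes -m_j - \<alpha>_j, again linear in m_j.\<close>

lemma fall_poly_cnj_uminus: "fall_poly d p \<Longrightarrow> fall_poly d (\<lambda>m. cnj (p (- m)))"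
proof (induction rule: fall_poly.induct)
  case (fall_poly_falling \<gamma> d)
  have "fall_poly (mi_size \<gamma>) (\<lambda>m. cnj (falling \<gamma> (- m)))"
  proof (induction \<gamma> rule: mi_induct)
    case zero
    have "(\<lambda>m. cnj (falling 0 (- m))) = falling (0 :: nat ^ 'a)" by (rule ext) simp
    then show ?case by (auto intro: fall_poly.fall_poly_falling)
  next
    case (add_axis \<alpha> j)
    have "fall_poly (Suc (mi_size \<alpha>)) (\<lambda>m. - 1 * (of_int (m $ j) * cnj (falling \<alpha> (- m))) +
        - of_nat (\<alpha> $ j) * cnj (falling \<alpha> (- m)))"
      by (intro fall_poly_add fall_poly_coord fall_poly_cmult fall_poly_mono[OF add_axis] add_axis) simp
    moreover have "(\<lambda>m. cnj (falling (\<alpha> + axis j 1) (- m))) = (\<lambda>m. - 1 * (of_int (m $ j) * cnj (falling \<alpha> (- m))) +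
        - of_nat (\<alpha> $ j) * cnj (falling \<alpha> (- m)))"
      by (rule ext) (simp only: falling_add_axis, simp add: algebra_simps)
    moreover have "mi_size (\<alpha> + axis j 1) = Suc (mi_size \<alpha>)" by (simp add: mi_size_add)
    ultimately show ?case by (simp only:)
  qed
  then show ?case using fall_poly_falling by (rule fall_poly_mono)
qed (auto intro: fall_poly_add fall_poly_cmult)

lemma rapidly_decreasing_fall_poly:
  fixes p :: "int ^ 'n::{finite,linorder} \<Rightarrow> complex"
  assumes "fall_poly d p" "c \<in> rapidly_decreasing"
  shows "(\<lambda>m. p m * c m) \<in> rapidly_decreasing"
  using assms
proof (induction rule: fall_poly.induct)
  case (fall_poly_add d p q)
  then show ?case by (simp add: distrib_right rapidly_decreasing_add)
next
  case (fall_poly_cmult d p a)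
  then show ?case by (simp add: mult.assoc rapidly_decreasing_cmult)
qed (auto intro: rapidly_decreasing_falling)


subsection \<open>Symbols in terms of their Fourier coefficients\<close>

text \<open>The symbol estimates for \<open>trig (b k)\<close>, with all polynomials in place of the
  falling factorials. That \<open>d\<close> only bounds the degree matters in
  \<open>coeff_class_decay\<close>, where the multiplier 1 is used at level
  \<open>p\<close>.\<close>

definition coeff_class ::
  "real \<Rightarrow> real \<Rightarrow> real \<Rightarrow>
   (int ^ 'n::{finite,linorder} \<Rightarrow> int ^ 'n::{finite,linorder} \<Rightarrow> complex) set" where
  "coeff_class \<mu> \<rho> \<delta> =
     {b. (\<forall>k. b k \<in> rapidly_decreasing) \<and>
         (\<forall>\<alpha> d q. fall_poly d q \<longrightarrow> (\<exists>C. \<forall>k x.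
            cmod (trig (\<lambda>m. q m * mi_diff_op \<alpha> (\<lambda>l. b l m) k) x)
              \<le> C * weight k powr (\<mu> - \<rho> * real (mi_size \<alpha>) + \<delta> * real d)))}"

lemma coeff_class_rapidly_decreasing: "b \<in> coeff_class \<mu> \<rho> \<delta> \<Longrightarrow> b k \<in> rapidly_decreasing"
  by (simp add: coeff_class_def)

lemma coeff_classE:
  assumes "b \<in> coeff_class \<mu> \<rho> \<delta>" "fall_poly d q"
  obtains C where "C > 0" "\<And>k x. cmod (trig (\<lambda>m. q m * mi_diff_op \<alpha> (\<lambda>l. b l m) k) x)
      \<le> C * weight k powr (\<mu> - \<rho> * real (mi_size \<alpha>) + \<delta> * real d)"
proof -
  obtain C where C: "\<And>k x. cmod (trig (\<lambda>m. q m * mi_diff_op \<alpha> (\<lambda>l. b l m) k) x)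
      \<le> C * weight k powr (\<mu> - \<rho> * real (mi_size \<alpha>) + \<delta> * real d)"
    using assms unfolding coeff_class_def by blast
  show thesis
  proof (rule that[of "max C 1"])
    fix k x
    show "cmod (trig (\<lambda>m. q m * mi_diff_op \<alpha> (\<lambda>l. b l m) k) x)
      \<le> max C 1 * weight k powr (\<mu> - \<rho> * real (mi_size \<alpha>) + \<delta> * real d)"
      by (rule order.trans[OF C]) (auto intro: mult_right_mono)
  qed simp
qed

text \<open>Fourier inversion identifies the symbol with the series of its coefficients; the
  estimates then extend from falling factorials to their linear combinations.\<close>

lemma coeff_class_of_symbol:
  assumes \<sigma>: "\<sigma> \<in> symbol_class \<mu> \<rho> \<delta>" and \<delta>: "0 \<le> \<delta>"
  shows "(\<lambda>k. fourier_coeff (\<sigma> k)) \<in> coeff_class \<mu> \<rho> \<delta>"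
proof -
  define b where "b k = fourier_coeff (\<sigma> k)" for k
  have smooth: "smooth_on_torus (\<sigma> k)" for k
    using \<sigma> by (simp add: symbol_class_def)
  have b: "b k \<in> rapidly_decreasing" for k
    unfolding b_def by (rule fourier_coeff_rapidly_decreasing[OF smooth])
  have \<sigma>_eq: "\<sigma> k = trig (b k)" for k
    unfolding b_def by (rule fourier_inversion[OF smooth, symmetric])
  have "\<exists>C. \<forall>k x. cmod (trig (\<lambda>m. q m * mi_diff_op \<alpha> (\<lambda>l. b l m) k) x)
              \<le> C * weight k powr (\<mu> - \<rho> * real (mi_size \<alpha>) + \<delta> * real d)"
    if "fall_poly d q" for \<alpha> d q
    using that
  proof (induction rule: fall_poly.induct)
    case (fall_poly_falling \<gamma> d)
    obtain C where C: "C > 0" "\<And>k x. cmod (mi_fall_deriv \<gamma> (\<lambda>y. mi_diff_op \<alpha> (\<lambda>l. \<sigma> l y) k) x)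
       \<le> C * weight k powr (\<mu> - \<rho> * real (mi_size \<alpha>) + \<delta> * real (mi_size \<gamma>))"
      using \<sigma> unfolding symbol_class_def by blast
    have "cmod (trig (\<lambda>m. falling \<gamma> m * mi_diff_op \<alpha> (\<lambda>l. b l m) k) x)
       \<le> C * weight k powr (\<mu> - \<rho> * real (mi_size \<alpha>) + \<delta> * real d)" for k x
    proof -
      have "(\<lambda>y. mi_diff_op \<alpha> (\<lambda>l. \<sigma> l y) k) = trig (\<lambda>m. mi_diff_op \<alpha> (\<lambda>l. b l m) k)"
        unfolding \<sigma>_eq by (rule ext) (rule mi_diff_op_trig(2)[of b, OF b])
      then have "cmod (trig (\<lambda>m. falling \<gamma> m * mi_diff_op \<alpha> (\<lambda>l. b l m) k) x) \<le>
          C * weight k powr (\<mu> - \<rho> * real (mi_size \<alpha>) + \<delta> * real (mi_size \<gamma>))"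
        using C(2)[of k x] mi_fall_deriv_trig(2)[OF rapidly_decreasing_mi_diff_op[of b, OF b]] by simp
      also have "\<dots> \<le> C * weight k powr (\<mu> - \<rho> * real (mi_size \<alpha>) + \<delta> * real d)"
        using C(1) fall_poly_falling \<delta> by (intro mult_left_mono powr_mono add_left_mono) auto
      finally show ?thesis .
    qed
    then show ?case by blast
  next
    case (fall_poly_add d p q)
    obtain C where C: "\<And>k x. cmod (trig (\<lambda>m. p m * mi_diff_op \<alpha> (\<lambda>l. b l m) k) x)
              \<le> C * weight k powr (\<mu> - \<rho> * real (mi_size \<alpha>) + \<delta> * real d)"
      using fall_poly_add.IH(1) by blast
    obtain D where D: "\<And>k x. cmod (trig (\<lambda>m. q m * mi_diff_op \<alpha> (\<lambda>l. b l m) k) x)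
              \<le> D * weight k powr (\<mu> - \<rho> * real (mi_size \<alpha>) + \<delta> * real d)"
      using fall_poly_add.IH(2) by blast
    have "cmod (trig (\<lambda>m. (p m + q m) * mi_diff_op \<alpha> (\<lambda>l. b l m) k) x)
        \<le> (C + D) * weight k powr (\<mu> - \<rho> * real (mi_size \<alpha>) + \<delta> * real d)" for k x
    proof -
      have "trig (\<lambda>m. (p m + q m) * mi_diff_op \<alpha> (\<lambda>l. b l m) k) x =
         trig (\<lambda>m. p m * mi_diff_op \<alpha> (\<lambda>l. b l m) k) x + trig (\<lambda>m. q m * mi_diff_op \<alpha> (\<lambda>l. b l m) k) x"
        unfolding distrib_right using fall_poly_add.hyps
        by (intro trig_add rapidly_decreasing_fall_poly rapidly_decreasing_mi_diff_op b)
      then show ?thesis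
        using norm_triangle_mono[OF C[of k x] D[of k x]] by (simp add: distrib_right)
    qed
    then show ?case by blast
  next
    case (fall_poly_cmult d p c)
    then obtain C where C: "\<And>k x. cmod (trig (\<lambda>m. p m * mi_diff_op \<alpha> (\<lambda>l. b l m) k) x)
              \<le> C * weight k powr (\<mu> - \<rho> * real (mi_size \<alpha>) + \<delta> * real d)" by blast
    have "cmod (trig (\<lambda>m. c * p m * mi_diff_op \<alpha> (\<lambda>l. b l m) k) x)
        \<le> (cmod c * C) * weight k powr (\<mu> - \<rho> * real (mi_size \<alpha>) + \<delta> * real d)" for k x
      using mult_left_mono[OF C[of k x], of "cmod c"] by (simp add: mult.assoc trig_cmult norm_mult)
    then show ?case by blast
  qed
  then show ?thesis
    using b unfolding coeff_class_def b_def by blast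
qed

lemma symbol_of_coeff_class:
  assumes b: "b \<in> coeff_class \<mu> \<rho> \<delta>"
  shows "(\<lambda>k. trig (b k)) \<in> symbol_class \<mu> \<rho> \<delta>"
  unfolding symbol_class_def
proof (intro CollectI conjI allI)
  note rd = coeff_class_rapidly_decreasing[OF b]
  show "smooth_on_torus (trig (b k))" for k by (rule smooth_on_torus_trig[OF rd])
  fix \<alpha> \<beta> :: "nat ^ 'a::{finite,linorder}"
  obtain C where C: "C > 0" "\<And>k x. cmod (trig (\<lambda>m. falling \<beta> m * mi_diff_op \<alpha> (\<lambda>l. b l m) k) x)
      \<le> C * weight k powr (\<mu> - \<rho> * real (mi_size \<alpha>) + \<delta> * real (mi_size \<beta>))"
    using coeff_classE[OF b fall_poly_falling[OF order_refl]] by blast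
  have "mi_fall_deriv \<beta> (\<lambda>y. mi_diff_op \<alpha> (\<lambda>l. trig (b l) y) k) =
      trig (\<lambda>m. falling \<beta> m * mi_diff_op \<alpha> (\<lambda>l. b l m) k)" for k
    unfolding mi_diff_op_trig(2)[of b, OF rd]
    by (rule mi_fall_deriv_trig(2)[OF rapidly_decreasing_mi_diff_op[of b, OF rd]])
  then show "\<exists>C>0. \<forall>k x. cmod (mi_fall_deriv \<beta> (\<lambda>y. mi_diff_op \<alpha> (\<lambda>l. trig (b l) y) k) x)
      \<le> C * weight k powr (\<mu> - \<rho> * real (mi_size \<alpha>) + \<delta> * real (mi_size \<beta>))"
    using C by auto
qed

lemma coeff_class_cnj_uminus:
  assumes b: "b \<in> coeff_class \<mu> \<rho> \<delta>"
  shows "(\<lambda>k m. cnj (b k (- m))) \<in> coeff_class \<mu> \<rho> \<delta>"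
  unfolding coeff_class_def
proof (intro CollectI conjI allI impI)
  show "(\<lambda>m. cnj (b k (- m))) \<in> rapidly_decreasing" for k
    by (intro rapidly_decreasing_cnj_uminus coeff_class_rapidly_decreasing[OF b])
  fix \<alpha> d and q :: "int ^ 'a::{finite,linorder} \<Rightarrow> complex" assume q: "fall_poly d q"
  obtain C where C: "\<And>k x. cmod (trig (\<lambda>m. cnj (q (- m)) * mi_diff_op \<alpha> (\<lambda>l. b l m) k) x)
      \<le> C * weight k powr (\<mu> - \<rho> * real (mi_size \<alpha>) + \<delta> * real d)"
    by (rule coeff_classE[OF b fall_poly_cnj_uminus[OF q], of \<alpha>]) blast
  have "trig (\<lambda>m. q m * mi_diff_op \<alpha> (\<lambda>l. cnj (b l (- m))) k) x =
      cnj (trig (\<lambda>m. cnj (q (- m)) * mi_diff_op \<alpha> (\<lambda>l. b l m) k) x)" for k x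
    by (simp add: trig_cnj mi_diff_op_cnj)
  then show "\<exists>C. \<forall>k x. cmod (trig (\<lambda>m. q m * mi_diff_op \<alpha> (\<lambda>l. cnj (b l (- m))) k) x)
      \<le> C * weight k powr (\<mu> - \<rho> * real (mi_size \<alpha>) + \<delta> * real d)"
    using C by auto
qed

text \<open>This lets a plain bound of a series, once proved for every order, be applied to
  differences and derivatives of the series, as \<open>newton_rem_coeff_class\<close> does.\<close>

lemma coeff_class_multiplier:
  assumes b: "b \<in> coeff_class \<mu> \<rho> \<delta>" and p: "fall_poly e p"
  shows "(\<lambda>k m. p m * mi_diff_op \<beta> (\<lambda>l. b l m) k)
    \<in> coeff_class (\<mu> - \<rho> * real (mi_size \<beta>) + \<delta> * real e) \<rho> \<delta>"
  unfolding coeff_class_def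
proof (intro CollectI conjI allI impI)
  show "(\<lambda>m. p m * mi_diff_op \<beta> (\<lambda>l. b l m) k) \<in> rapidly_decreasing" for k
    by (intro rapidly_decreasing_fall_poly[OF p] rapidly_decreasing_mi_diff_op
        coeff_class_rapidly_decreasing[OF b])
  fix \<alpha> d and q :: "int ^ 'a::{finite,linorder} \<Rightarrow> complex" assume q: "fall_poly d q"
  obtain C where C: "\<And>k x. cmod (trig (\<lambda>m. (q m * p m) * mi_diff_op (\<alpha> + \<beta>) (\<lambda>l. b l m) k) x)
      \<le> C * weight k powr (\<mu> - \<rho> * real (mi_size (\<alpha> + \<beta>)) + \<delta> * real (d + e))"
    by (rule coeff_classE[OF b fall_poly_mult[OF q p], of "\<alpha> + \<beta>"]) blast
  have eq: "q m * mi_diff_op \<alpha> (\<lambda>l. p m * mi_diff_op \<beta> (\<lambda>l. b l m) l) k =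
      (q m * p m) * mi_diff_op (\<alpha> + \<beta>) (\<lambda>l. b l m) k" for k m
    by (simp add: mi_diff_op_cmult mi_diff_op_mi_diff_op)
  have "cmod (trig (\<lambda>m. q m * mi_diff_op \<alpha> (\<lambda>l. p m * mi_diff_op \<beta> (\<lambda>l. b l m) l) k) x)
      \<le> C * weight k powr (\<mu> - \<rho> * real (mi_size \<beta>) + \<delta> * real e - \<rho> * real (mi_size \<alpha>) + \<delta> * real d)" for k x
    unfolding eq by (rule order.trans[OF C]) (simp add: mi_size_add algebra_simps)
  then show "\<exists>C. \<forall>k x. cmod (trig (\<lambda>m. q m * mi_diff_op \<alpha> (\<lambda>l. p m * mi_diff_op \<beta> (\<lambda>l. b l m) l) k) x)
      \<le> C * weight k powr (\<mu> - \<rho> * real (mi_size \<beta>) + \<delta> * real e - \<rho> * real (mi_size \<alpha>) + \<delta> * real d)"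
    by blast
qed

text \<open>If |z| \<ge> 2 p, every factor satisfies |z - i| \<ge> |z| / 2, whence 1 + |z| \<le> 4
  |z - i|. If |z| < 2 p, the left side is bounded by a constant; the summand 1 covers this range,
  where the product may vanish.\<close>

lemma power_le_falling:
  fixes z :: int
  shows "(1 + \<bar>real_of_int z\<bar>) ^ p \<le>
    (4 + 2 * real p) ^ p * (1 + cmod (\<Prod>i<p. of_int z - of_nat i))"
proof (cases "\<bar>z\<bar> < 2 * int p")
  case True
  then have "\<bar>real_of_int z\<bar> \<le> 2 * real p" by linarith
  then have "(1 + \<bar>real_of_int z\<bar>) ^ p \<le> (4 + 2 * real p) ^ p * 1"
    by (simp add: power_mono)
  also have "\<dots> \<le> (4 + 2 * real p) ^ p * (1 + cmod (\<Prod>i<p. of_int z - of_nat i))"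
    by (intro mult_left_mono) auto
  finally show ?thesis .
next
  case False
  have "(1 + \<bar>real_of_int z\<bar>) ^ p = (\<Prod>i<p. 1 + \<bar>real_of_int z\<bar>)" by simp
  also have "\<dots> \<le> (\<Prod>i<p. 4 * cmod (of_int z - of_nat i))"
  proof (rule prod_mono, safe)
    fix i assume "i < p"
    then have "1 + \<bar>z\<bar> \<le> 4 * \<bar>z - int i\<bar>" using False
      by (cases "0 \<le> z") (simp_all add: abs_if)
    then have "1 + \<bar>real_of_int z\<bar> \<le> 4 * \<bar>real_of_int (z - int i)\<bar>" by linarith
    also have "\<bar>real_of_int (z - int i)\<bar> = cmod (of_int z - of_nat i)"
      by (metis norm_of_int of_int_diff of_int_of_nat_eq)
    finally show "1 + \<bar>real_of_int z\<bar> \<le> 4 * cmod (of_int z - of_nat i)" .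
  qed simp
  also have "\<dots> = 4 ^ p * cmod (\<Prod>i<p. of_int z - of_nat i)"
    by (simp add: prod.distrib prod_norm)
  also have "\<dots> \<le> (4 + 2 * real p) ^ p * (1 + cmod (\<Prod>i<p. of_int z - of_nat i))"
    by (intro mult_mono power_mono) auto
  finally show ?thesis .
qed

text \<open>For given m, the falling factorial of order p in the largest coordinate together with
  the multiplier 1 dominates \<open>weight m ^ p\<close>. Only finitely many multipliers of degree
  at most p occur, and their supremum bounds pass to the coefficients.\<close>

lemma coeff_class_decay:
  fixes b :: "int ^ 'n::{finite,linorder} \<Rightarrow> int ^ 'n::{finite,linorder} \<Rightarrow> complex"
  assumes b: "b \<in> coeff_class \<mu> \<rho> \<delta>"
  obtains C where "C > 0" "\<And>k m. weight m ^ p * cmod (mi_diff_op \<alpha> (\<lambda>l. b l m) k)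
     \<le> C * weight k powr (\<mu> - \<rho> * real (mi_size \<alpha>) + \<delta> * real p)"
proof -
  define s where "s = \<mu> - \<rho> * real (mi_size \<alpha>) + \<delta> * real p"
  have coeff: "\<exists>C>0. \<forall>k m. cmod (falling \<gamma> m) * cmod (mi_diff_op \<alpha> (\<lambda>l. b l m) k) \<le> C * weight k powr s"
    if \<gamma>: "mi_size \<gamma> \<le> p" for \<gamma>
  proof -
    obtain C where C: "C > 0" "\<And>k x. cmod (trig (\<lambda>m. falling \<gamma> m * mi_diff_op \<alpha> (\<lambda>l. b l m) k) x)
        \<le> C * weight k powr s"
      using coeff_classE[OF b fall_poly_falling[OF \<gamma>]] unfolding s_def by blast
    have "cmod (falling \<gamma> m * mi_diff_op \<alpha> (\<lambda>l. b l m) k) \<le> C * weight k powr s" for k m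
      by (rule norm_coeff_le_trig[OF _ C(2)])
         (intro rapidly_decreasing_falling rapidly_decreasing_mi_diff_op coeff_class_rapidly_decreasing[OF b])
    then show ?thesis using C(1) by (auto simp: norm_mult)
  qed
  obtain C0 where C0: "C0 > 0" "\<And>k m. cmod (mi_diff_op \<alpha> (\<lambda>l. b l m) k) \<le> C0 * weight k powr s"
    using coeff[of 0] by auto
  have "\<forall>j. \<exists>C>0. \<forall>k m. cmod (falling (axis j p) m) * cmod (mi_diff_op \<alpha> (\<lambda>l. b l m) k) \<le> C * weight k powr s"
    using coeff by simp
  then obtain C where C: "\<And>j. C j > 0" "\<And>j k m. cmod (falling (axis j p) m) *
      cmod (mi_diff_op \<alpha> (\<lambda>l. b l m) k) \<le> C j * weight k powr s"
    by metis
  define D where "D = (1 + real CARD('n)) ^ p * (4 + 2 * real p) ^ p"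
  have "D > 0" unfolding D_def by (intro mult_pos_pos zero_less_power) auto
  define K where "K = D * (C0 + (\<Sum>j\<in>UNIV. C j))"
  have Cj: "C j \<le> (\<Sum>j\<in>UNIV. C j)" for j
    using C(1) by (intro member_le_sum) (auto intro: less_imp_le)
  have "weight m ^ p * cmod (mi_diff_op \<alpha> (\<lambda>l. b l m) k) \<le> K * weight k powr s" for k m
  proof -
    obtain j where "weight m ^ p \<le> (1 + real CARD('n)) ^ p * (1 + \<bar>real_of_int (m $ j)\<bar>) ^ p"
      by (rule weight_power_le)
    also have "\<dots> \<le> (1 + real CARD('n)) ^ p * ((4 + 2 * real p) ^ p * (1 + cmod (falling (axis j p) m)))"
      unfolding falling_axis by (intro mult_left_mono power_le_falling) auto
    also have "\<dots> = D * (1 + cmod (falling (axis j p) m))" by (simp add: D_def)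
    finally have "weight m ^ p * cmod (mi_diff_op \<alpha> (\<lambda>l. b l m) k) \<le>
        D * (1 + cmod (falling (axis j p) m)) * cmod (mi_diff_op \<alpha> (\<lambda>l. b l m) k)"
      by (rule mult_right_mono) simp
    also have "\<dots> = D * (cmod (mi_diff_op \<alpha> (\<lambda>l. b l m) k) +
        cmod (falling (axis j p) m) * cmod (mi_diff_op \<alpha> (\<lambda>l. b l m) k))"
      by (simp add: algebra_simps)
    also have "\<dots> \<le> D * (C0 * weight k powr s + C j * weight k powr s)"
      using \<open>D > 0\<close> by (intro mult_left_mono add_mono C C0) auto
    also have "\<dots> \<le> D * (C0 * weight k powr s + (\<Sum>j\<in>UNIV. C j) * weight k powr s)"
      using \<open>D > 0\<close> Cj by (intro mult_left_mono add_left_mono mult_right_mono) auto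
    finally show ?thesis by (simp add: K_def algebra_simps)
  qed
  moreover have "K > 0"
    unfolding K_def using \<open>D > 0\<close> C0(1) C(1) by (intro mult_pos_pos add_pos_nonneg sum_nonneg) (auto intro: less_imp_le)
  ultimately show thesis using that unfolding s_def by blast
qed

subsection \<open>The remainder estimate\<close>

text \<open>Submultiplicativity of \<open>weight\<close> is applied to k = (k + \<theta>) +
  (-\<theta>), and the non-positive exponent reverses the inequality.\<close>

lemma weight_powr_add_le:
  assumes "s \<le> 0"
  shows "weight (k + \<theta>) powr s \<le> weight k powr s * weight \<theta> powr (- s)"
proof -
  have "weight k \<le> weight (k + \<theta>) * weight \<theta>"
    using weight_add_le[of "k + \<theta>" "- \<theta>"] by simp
  then have "(weight (k + \<theta>) * weight \<theta>) powr s \<le> weight k powr s"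
    using assms by (intro powr_mono2') auto
  then show ?thesis
    by (simp add: powr_mult powr_minus divide_simps)
qed

lemma coeff_class_decay_0:
  fixes b :: "int ^ 'n::{finite,linorder} \<Rightarrow> int ^ 'n::{finite,linorder} \<Rightarrow> complex"
  assumes b: "b \<in> coeff_class \<mu> \<rho> \<delta>"
  obtains C where "C > 0" "\<And>k m. weight m ^ p * cmod (b k m) \<le> C * weight k powr (\<mu> + \<delta> * real p)"
proof (rule coeff_class_decay[OF b, where \<alpha> = 0 and p = p])
  fix C
  assume "C > 0" and C: "\<And>k m. weight m ^ p * cmod (mi_diff_op 0 (\<lambda>l. b l m) k)
     \<le> C * weight k powr (\<mu> - \<rho> * real (mi_size (0 :: nat ^ 'n::{finite,linorder})) + \<delta> * real p)"
  show thesis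
  proof (rule that[OF \<open>C > 0\<close>])
    show "weight m ^ p * cmod (b k m) \<le> C * weight k powr (\<mu> + \<delta> * real p)" for k m
      using C[of m k] by simp
  qed
qed

text \<open>P powers of decay in m cost \<delta> P powers of \<open>weight (k + m)\<close>, thus at
  most as many of \<open>weight m\<close>. Since \<delta> < 1, the net gain (1 - \<delta>) P -
  |\<mu>| reaches p for large P. The absolute value makes the exponent \<open>e\<close>
  non-negative, so that submultiplicativity can be used.\<close>

lemma coeff_class_shift_rapidly_decreasing:
  fixes b :: "int ^ 'n::{finite,linorder} \<Rightarrow> int ^ 'n::{finite,linorder} \<Rightarrow> complex"
  assumes b: "b \<in> coeff_class \<mu> \<rho> \<delta>" and \<delta>: "0 \<le> \<delta>" "\<delta> < 1"
  shows "(\<lambda>m. b (k + m) m) \<in> rapidly_decreasing"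
  unfolding rapidly_decreasing_iff
proof
  fix p :: nat
  define P where "P = nat \<lceil>(real p + \<bar>\<mu>\<bar>) / (1 - \<delta>)\<rceil>"
  define e where "e = \<bar>\<mu>\<bar> + \<delta> * real P"
  have "(real p + \<bar>\<mu>\<bar>) / (1 - \<delta>) \<le> real P" unfolding P_def by linarith
  then have P: "real p + e \<le> real P"
    using \<delta> by (simp add: e_def divide_simps algebra_simps)
  obtain C where C: "C > 0" "\<And>k m. weight m ^ P * cmod (b k m) \<le> C * weight k powr (\<mu> + \<delta> * real P)"
    using coeff_class_decay_0[OF b, of P] by blast
  have "weight m ^ p * cmod (b (k + m) m) \<le> C * weight k powr e" for m
  proof -
    have "weight m ^ P * cmod (b (k + m) m) \<le> C * weight (k + m) powr (\<mu> + \<delta> * real P)"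
      by (rule C(2))
    also have "\<dots> \<le> C * weight (k + m) powr e"
      using C(1) by (intro mult_left_mono powr_mono) (auto simp: e_def)
    also have "\<dots> \<le> C * (weight k * weight m) powr e"
      using C(1) \<delta> by (intro mult_left_mono powr_mono2 weight_add_le) (auto simp: e_def)
    also have "\<dots> = C * weight k powr e * weight m powr e" by (simp add: powr_mult)
    finally have *: "weight m ^ P * cmod (b (k + m) m) \<le> C * weight k powr e * weight m powr e" .
    have "weight m ^ p * cmod (b (k + m) m) =
        weight m powr (real p - real P) * (weight m ^ P * cmod (b (k + m) m))"
      by (simp add: powr_diff powr_realpow)
    also have "\<dots> \<le> weight m powr (real p - real P) * (C * weight k powr e * weight m powr e)"
      by (intro mult_left_mono * ) auto
    also have "\<dots> = C * weight k powr e * weight m powr (real p - real P + e)"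
      by (simp add: powr_add)
    also have "\<dots> \<le> C * weight k powr e * weight m powr 0"
      using C(1) P by (intro mult_left_mono powr_mono) auto
    finally show ?thesis by simp
  qed
  then show "\<exists>C. \<forall>m. weight m ^ p * cmod (b (k + m) m) \<le> C" by blast
qed

lemma rapidly_decreasing_newton_rem:
  assumes b: "b \<in> coeff_class \<mu> \<rho> \<delta>" and \<delta>: "0 \<le> \<delta>" "\<delta> < 1"
  shows "(\<lambda>m. newton_rem N (\<lambda>l. b l m) k m) \<in> rapidly_decreasing"
  unfolding newton_rem_def
  by (intro rapidly_decreasing_diff coeff_class_shift_rapidly_decreasing[OF assms]
      rapidly_decreasing_sum rapidly_decreasing_cmult rapidly_decreasing_falling
      rapidly_decreasing_mi_diff_op coeff_class_rapidly_decreasing[OF b])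

text \<open>
  With \<open>\<epsilon> = \<rho> - \<delta>\<close>, the choice \<open>M \<approx> (1 + 2 \<epsilon> / (1 + \<delta>)) N'\<close> makes both exponents of the
  remainder estimate tend to \<open>-\<infinity>\<close> as \<open>N'\<close> grows; this needs \<open>\<delta> < \<rho>\<close> and \<open>\<delta> < 1\<close>.
\<close>

lemma remainder_exponents:
  fixes \<mu> \<rho> \<delta> T E :: real and N :: nat
  assumes "0 \<le> \<delta>" "\<delta> < \<rho>" "\<rho> \<le> 1"
  obtains N' M :: nat where "N \<le> N'" "\<mu> - \<rho> * real N' + \<delta> * real M \<le> T"
    "real N' - real M - (\<mu> - \<rho> * real N' + \<delta> * real M) \<le> - E"
proof -
  define \<epsilon> where "\<epsilon> = \<rho> - \<delta>"
  define \<kappa> where "\<kappa> = (1 - \<delta>) / (1 + \<delta>)"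
  have pos: "0 < \<epsilon>" "0 < \<kappa>" using assms by (auto simp: \<epsilon>_def \<kappa>_def)
  obtain N1 :: nat where N1: "(\<mu> + 1 - T) / (\<epsilon> * \<kappa>) \<le> real N1"
    using real_arch_simple by blast
  obtain N2 :: nat where N2: "(E - \<mu>) / \<epsilon> \<le> real N2"
    using real_arch_simple by blast
  define N' where "N' = max N (max N1 N2)"
  define c where "c = 1 + 2 * \<epsilon> / (1 + \<delta>)"
  define M where "M = nat \<lceil>c * real N'\<rceil>"
  have "0 \<le> c * real N'" using pos assms by (simp add: c_def)
  then have "real M = of_int \<lceil>c * real N'\<rceil>" by (simp add: M_def)
  then have M: "c * real N' \<le> real M" "real M \<le> c * real N' + 1" by linarith+
  have a1: "\<mu> + 1 - T \<le> \<epsilon> * \<kappa> * real N'"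
  proof -
    have "(\<mu> + 1 - T) / (\<epsilon> * \<kappa>) \<le> real N'" using N1 by (simp add: N'_def)
    then show ?thesis using pos by (simp add: divide_simps mult_ac)
  qed
  have a2: "E - \<mu> \<le> \<epsilon> * real N'"
  proof -
    have "(E - \<mu>) / \<epsilon> \<le> real N'" using N2 by (simp add: N'_def)
    then show ?thesis using pos by (simp add: divide_simps mult_ac)
  qed
  have c1: "\<rho> - \<delta> * c = \<epsilon> * \<kappa>"
    using assms by (simp add: c_def \<kappa>_def \<epsilon>_def field_simps)
  have c2: "(1 + \<delta>) * c = 1 + \<delta> + 2 * \<epsilon>"
    using assms by (simp add: c_def field_simps)
  show thesis
  proof (rule that[of N' M])
    show "N \<le> N'" by (simp add: N'_def)
    have "\<delta> * real M \<le> \<delta> * (c * real N' + 1)"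
      using M assms by (intro mult_left_mono) auto
    moreover have "\<delta> * (c * real N' + 1) = \<rho> * real N' - \<epsilon> * \<kappa> * real N' + \<delta>"
      unfolding c1[symmetric] by (simp add: algebra_simps)
    ultimately show "\<mu> - \<rho> * real N' + \<delta> * real M \<le> T"
      using a1 assms by linarith
    have "(1 + \<delta>) * (c * real N') \<le> (1 + \<delta>) * real M"
      using M assms by (intro mult_left_mono) auto
    moreover have "(1 + \<delta>) * (c * real N') = real N' + \<delta> * real N' + 2 * (\<epsilon> * real N')"
      unfolding mult.assoc[symmetric] c2 by (simp add: algebra_simps)
    moreover have "\<rho> * real N' = \<epsilon> * real N' + \<delta> * real N'"
      by (simp add: \<epsilon>_def algebra_simps)
    moreover have "(1 + \<delta>) * real M = real M + \<delta> * real M" by (simp add: algebra_simps)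
    ultimately show "real N' - real M - (\<mu> - \<rho> * real N' + \<delta> * real M) \<le> - E"
      using a2 by linarith
  qed
qed

text \<open>\<open>norm_newton_rem_le\<close> is applied to \<open>\<lambda>l. b l m\<close> with L
  the path length of m. The powers of \<open>weight m\<close> are N from the path, -M from the decay
  of the coefficients, and -s from moving k + \<theta> back to k.\<close>

lemma newton_rem_coeff_bound:
  fixes b :: "int ^ 'n::{finite,linorder} \<Rightarrow> int ^ 'n::{finite,linorder} \<Rightarrow> complex"
  assumes b: "b \<in> coeff_class \<mu> \<rho> \<delta>" and s: "s = \<mu> - \<rho> * real N + \<delta> * real M" "s \<le> 0"
  obtains C where "C > 0" "\<And>k m. cmod (newton_rem N (\<lambda>l. b l m) k m)
    \<le> C * weight k powr s * weight m powr (real N - real M - s)"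
proof -
  have "\<forall>\<alpha>. \<exists>C>0. mi_size \<alpha> = N \<longrightarrow> (\<forall>k m. weight m ^ M * cmod (mi_diff_op \<alpha> (\<lambda>l. b l m) k) \<le> C * weight k powr s)"
  proof
    fix \<alpha> :: "nat ^ 'n::{finite,linorder}"
    obtain C where "C > 0" "\<And>k m. weight m ^ M * cmod (mi_diff_op \<alpha> (\<lambda>l. b l m) k)
       \<le> C * weight k powr (\<mu> - \<rho> * real (mi_size \<alpha>) + \<delta> * real M)"
      by (rule coeff_class_decay[OF b, of M \<alpha>]) blast
    then show "\<exists>C>0. mi_size \<alpha> = N \<longrightarrow> (\<forall>k m. weight m ^ M * cmod (mi_diff_op \<alpha> (\<lambda>l. b l m) k) \<le> C * weight k powr s)"
      unfolding s(1) by blast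
  qed
  then obtain c where c: "\<And>\<alpha>. c \<alpha> > 0" "\<And>\<alpha> k m. mi_size \<alpha> = N \<Longrightarrow>
      weight m ^ M * cmod (mi_diff_op \<alpha> (\<lambda>l. b l m) k) \<le> c \<alpha> * weight k powr s"
    by metis
  \<comment> \<open>The maximum over |\<alpha>| = N is replaced by the sum over |\<alpha>| \<le> N,
    a set already known to be finite.\<close>
  define C where "C = (\<Sum>\<alpha> | mi_size (\<alpha> :: nat ^ 'n::{finite,linorder}) < Suc N. c \<alpha>)"
  have cC: "c \<alpha> \<le> C" if "mi_size \<alpha> = N" for \<alpha>
    unfolding C_def using that c(1) finite_mi_size_less
    by (intro member_le_sum) (auto intro: less_imp_le)
  have "C > 0"
    using c(1)[of "axis undefined N"] cC[of "axis undefined N"] by simp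
  define n where "n = real CARD('n)"
  have n: "0 < n" by (simp add: n_def)
  define K where "K = n ^ N * (C * (1 + n) powr (- s))"
  have "K > 0" using n \<open>C > 0\<close> by (simp add: K_def)
  have l1: "real (l1_size m) \<le> n * weight m" for m :: "int ^ 'n::{finite,linorder}"
    using l1_size_le[of m] n by (simp add: n_def algebra_simps)
  have "cmod (newton_rem N (\<lambda>l. b l m) k m) \<le> K * weight k powr s * weight m powr (real N - real M - s)" for k m
  proof -
    define B where "B = C * weight m powr (- real M) * (weight k powr s * ((1 + n) * weight m) powr (- s))"
    have "cmod (newton_rem N (\<lambda>l. b l m) k m) \<le> real (l1_size m) ^ N * B"
    proof (rule norm_newton_rem_le)
      fix \<alpha> :: "nat ^ 'n::{finite,linorder}" and \<theta> :: "int ^ 'n::{finite,linorder}"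
      assume \<alpha>: "mi_size \<alpha> = N" and \<theta>: "l1_size \<theta> \<le> l1_size m"
      have "weight \<theta> \<le> 1 + real (l1_size m)"
        using lattice_norm_le_l1_size[of \<theta>] \<theta> by linarith
      also have "\<dots> \<le> (1 + n) * weight m"
        using l1[of m] weight_ge_1[of m] by (simp only: distrib_right mult_1 add_mono)
      finally have w: "weight \<theta> \<le> (1 + n) * weight m" .
      have "weight m ^ M * cmod (mi_diff_op \<alpha> (\<lambda>l. b l m) (k + \<theta>)) \<le> c \<alpha> * weight (k + \<theta>) powr s"
        by (rule c(2)[OF \<alpha>])
      also have "\<dots> \<le> C * (weight k powr s * weight \<theta> powr (- s))"
        using \<open>C > 0\<close> by (intro mult_mono cC \<alpha> weight_powr_add_le s) auto
      also have "\<dots> \<le> C * (weight k powr s * ((1 + n) * weight m) powr (- s))"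
        using \<open>C > 0\<close> s by (intro mult_left_mono powr_mono2 w) auto
      finally have "weight m ^ M * cmod (mi_diff_op \<alpha> (\<lambda>l. b l m) (k + \<theta>))
        \<le> C * (weight k powr s * ((1 + n) * weight m) powr (- s))" .
      then have "weight m powr (- real M) * (weight m ^ M * cmod (mi_diff_op \<alpha> (\<lambda>l. b l m) (k + \<theta>)))
        \<le> weight m powr (- real M) * (C * (weight k powr s * ((1 + n) * weight m) powr (- s)))"
        by (rule mult_left_mono) simp
      also have "weight m powr (- real M) * (weight m ^ M * cmod (mi_diff_op \<alpha> (\<lambda>l. b l m) (k + \<theta>))) =
          cmod (mi_diff_op \<alpha> (\<lambda>l. b l m) (k + \<theta>))"
        by (simp add: powr_minus powr_realpow)
      finally show "cmod (mi_diff_op \<alpha> (\<lambda>l. b l m) (k + \<theta>)) \<le> B"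
        by (simp only: B_def mult_ac)
    qed simp
    also have "\<dots> \<le> (n * weight m) ^ N * B"
      using \<open>C > 0\<close> l1 by (intro mult_right_mono power_mono) (auto simp: B_def)
    also have "\<dots> = K * weight k powr s * (weight m powr real N * weight m powr (- real M) * weight m powr (- s))"
      using n by (simp add: B_def K_def powr_mult power_mult_distrib powr_realpow mult_ac)
    also have "\<dots> = K * weight k powr s * weight m powr (real N - real M - s)"
      by (simp flip: powr_add)
    finally show ?thesis .
  qed
  then show thesis using that \<open>K > 0\<close> by blast
qed

lemma trig_newton_rem_bound:
  fixes b :: "int ^ 'n::{finite,linorder} \<Rightarrow> int ^ 'n::{finite,linorder} \<Rightarrow> complex"
  assumes \<rho>\<delta>: "0 \<le> \<delta>" "\<delta> < \<rho>" "\<rho> \<le> 1" and b: "b \<in> coeff_class \<mu> \<rho> \<delta>"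
  shows "\<exists>C. \<forall>k x. cmod (trig (\<lambda>m. newton_rem N (\<lambda>l. b l m) k m) x)
    \<le> C * weight k powr (\<mu> - real N * (\<rho> - \<delta>))"
proof -
  define T where "T = \<mu> - real N * (\<rho> - \<delta>)"
  \<comment> \<open>The bound by 0 makes Peetre's inequality applicable, the bound by T gives the
    required order, and the exponent -2 n in m makes the sum over m converge.\<close>
  obtain N' M where NM: "N \<le> N'" "\<mu> - \<rho> * real N' + \<delta> * real M \<le> min 0 T"
    "real N' - real M - (\<mu> - \<rho> * real N' + \<delta> * real M) \<le> - real (2 * CARD('n))"
    using remainder_exponents[OF \<rho>\<delta>] by blast
  define s where "s = \<mu> - \<rho> * real N' + \<delta> * real M"
  have s: "s \<le> 0" "s \<le> T" "real N' - real M - s \<le> - real (2 * CARD('n))"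
    using NM by (auto simp: s_def)
  obtain C where C: "C > 0" "\<And>k m. cmod (newton_rem N' (\<lambda>l. b l m) k m)
    \<le> C * weight k powr s * weight m powr (real N' - real M - s)"
    using newton_rem_coeff_bound[OF b s_def s(1)] by blast
  define S where "S = (\<Sum>\<^sub>\<infinity>m::int ^ 'n::{finite,linorder}. 1 / weight m ^ (2 * CARD('n)))"
  have S0: "0 \<le> S" unfolding S_def by (intro infsum_nonneg) simp
  have tail: "cmod (trig (\<lambda>m. newton_rem N' (\<lambda>l. b l m) k m) x) \<le> C * S * weight k powr T" for k x
  proof -
    have le: "weight m ^ (2 * CARD('n)) * norm (newton_rem N' (\<lambda>l. b l m) k m) \<le> C * weight k powr s" for m
    proof -
      have "weight m ^ (2 * CARD('n)) * cmod (newton_rem N' (\<lambda>l. b l m) k m) \<le>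
          weight m powr real (2 * CARD('n)) * (C * weight k powr s * weight m powr (- real (2 * CARD('n))))"
        unfolding powr_realpow[OF weight_pos]
        by (intro mult_left_mono order.trans[OF C(2)] powr_mono s) (use C(1) in auto)
      also have "\<dots> = C * weight k powr s" by (simp add: powr_minus)
      finally show ?thesis .
    qed
    have "cmod (trig (\<lambda>m. newton_rem N' (\<lambda>l. b l m) k m) x) \<le> C * weight k powr s * S"
      using norm_trig_le[OF abs_summable_on_weight(1)[OF le]] abs_summable_on_weight(2)[OF le]
      unfolding S_def by (rule order.trans)
    also have "\<dots> \<le> C * weight k powr T * S"
      using C(1) S0 s by (intro mult_right_mono mult_left_mono powr_mono) auto
    finally show ?thesis by (simp add: mult_ac)
  qed
  \<comment> \<open>The terms by which the two expansions differ. Their order \<mu> - (\<rho> -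
    \<delta>) |\<alpha>| is at most T because |\<alpha>| \<ge> N.\<close>
  define A where "A = {\<alpha> :: nat ^ 'n::{finite,linorder}. mi_size \<alpha> < N'} - {\<alpha>. mi_size \<alpha> < N}"
  define t where "t \<alpha> k m = 1 / of_nat (mi_fact \<alpha>) * (falling \<alpha> m * mi_diff_op \<alpha> (\<lambda>l. b l m) k)" for \<alpha> k m
  have t_rd: "t \<alpha> k \<in> rapidly_decreasing" for \<alpha> k
    unfolding t_def by (intro rapidly_decreasing_cmult rapidly_decreasing_falling
      rapidly_decreasing_mi_diff_op coeff_class_rapidly_decreasing[OF b])
  have "\<forall>\<alpha>. \<exists>C. \<alpha> \<in> A \<longrightarrow> (\<forall>k x. cmod (trig (t \<alpha> k) x) \<le> C * weight k powr T)"
  proof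
    fix \<alpha>
    obtain C where C: "C > 0" "\<And>k x. cmod (trig (\<lambda>m. falling \<alpha> m * mi_diff_op \<alpha> (\<lambda>l. b l m) k) x)
        \<le> C * weight k powr (\<mu> - \<rho> * real (mi_size \<alpha>) + \<delta> * real (mi_size \<alpha>))"
      using coeff_classE[OF b fall_poly_falling[OF order_refl]] by blast
    have "cmod (trig (t \<alpha> k) x) \<le> (1 / real (mi_fact \<alpha>) * C) * weight k powr T" if "\<alpha> \<in> A" for k x
    proof -
      have "real N * (\<rho> - \<delta>) \<le> real (mi_size \<alpha>) * (\<rho> - \<delta>)"
        using that \<rho>\<delta> by (intro mult_right_mono) (auto simp: A_def)
      then have "\<mu> - \<rho> * real (mi_size \<alpha>) + \<delta> * real (mi_size \<alpha>) \<le> T"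
        by (simp add: T_def algebra_simps)
      then have "cmod (trig (\<lambda>m. falling \<alpha> m * mi_diff_op \<alpha> (\<lambda>l. b l m) k) x) \<le> C * weight k powr T"
        using C(1) by (intro order.trans[OF C(2)] mult_left_mono powr_mono) auto
      then show ?thesis
        unfolding t_def trig_cmult norm_mult mult.assoc
        by (simp add: norm_divide divide_right_mono)
    qed
    then show "\<exists>C. \<alpha> \<in> A \<longrightarrow> (\<forall>k x. cmod (trig (t \<alpha> k) x) \<le> C * weight k powr T)" by blast
  qed
  then obtain c where c: "\<And>\<alpha> k x. \<alpha> \<in> A \<Longrightarrow> cmod (trig (t \<alpha> k) x) \<le> c \<alpha> * weight k powr T"
    by metis
  have \<delta>1: "\<delta> < 1" using \<rho>\<delta> by simp
  have "cmod (trig (\<lambda>m. newton_rem N (\<lambda>l. b l m) k m) x) \<le> (C * S + (\<Sum>\<alpha>\<in>A. c \<alpha>)) * weight k powr T" for k x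
  proof -
    have "newton_rem N (\<lambda>l. b l m) k m = newton_rem N' (\<lambda>l. b l m) k m + (\<Sum>\<alpha>\<in>A. t \<alpha> k m)" for m
    proof -
      have "{\<alpha> :: nat ^ 'n::{finite,linorder}. mi_size \<alpha> < N} \<subseteq> {\<alpha>. mi_size \<alpha> < N'}" using NM(1) by auto
      then have "(\<Sum>\<alpha> | mi_size \<alpha> < N'. t \<alpha> k m) = (\<Sum>\<alpha>\<in>A. t \<alpha> k m) + (\<Sum>\<alpha> | mi_size \<alpha> < N. t \<alpha> k m)"
        unfolding A_def by (intro sum.subset_diff finite_mi_size_less)
      then show ?thesis by (simp add: newton_rem_def t_def)
    qed
    then have "trig (\<lambda>m. newton_rem N (\<lambda>l. b l m) k m) x =
        trig (\<lambda>m. newton_rem N' (\<lambda>l. b l m) k m + (\<Sum>\<alpha>\<in>A. t \<alpha> k m)) x" by presburger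
    also have "\<dots> = trig (\<lambda>m. newton_rem N' (\<lambda>l. b l m) k m) x + (\<Sum>\<alpha>\<in>A. trig (t \<alpha> k) x)"
      by (simp add: trig_add trig_sum t_rd rapidly_decreasing_sum
          rapidly_decreasing_newton_rem[OF b \<rho>\<delta>(1) \<delta>1])
    also have "cmod \<dots> \<le> C * S * weight k powr T + (\<Sum>\<alpha>\<in>A. c \<alpha> * weight k powr T)"
      by (intro norm_triangle_mono tail sum_norm_le c)
    finally show ?thesis by (simp add: distrib_right sum_distrib_right)
  qed
  then show ?thesis unfolding T_def by blast
qed

text \<open>With multiplier and differences moved inside, the remainder is that of a class member of
  order \<mu> - \<rho> |\<alpha>| + \<delta> d, and N (\<rho> - \<delta>) is subtracted from this
  order.\<close>

lemma newton_rem_coeff_class: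
  assumes \<rho>\<delta>: "0 \<le> \<delta>" "\<delta> < \<rho>" "\<rho> \<le> 1" and b: "b \<in> coeff_class \<mu> \<rho> \<delta>"
  shows "(\<lambda>k m. newton_rem N (\<lambda>l. b l m) k m) \<in> coeff_class (\<mu> - real N * (\<rho> - \<delta>)) \<rho> \<delta>"
  unfolding coeff_class_def
proof (intro CollectI conjI allI impI)
  show "(\<lambda>m. newton_rem N (\<lambda>l. b l m) k m) \<in> rapidly_decreasing" for k
    using \<rho>\<delta> by (intro rapidly_decreasing_newton_rem[OF b]) auto
  fix \<alpha> d and q :: "int ^ 'a::{finite,linorder} \<Rightarrow> complex" assume q: "fall_poly d q"
  have eq: "q m * mi_diff_op \<alpha> (\<lambda>l. newton_rem N (\<lambda>l'. b l' m) l m) k =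
      newton_rem N (\<lambda>l. q m * mi_diff_op \<alpha> (\<lambda>l. b l m) l) k m" for k m
    by (simp add: mi_diff_op_newton_rem newton_rem_cmult)
  show "\<exists>C. \<forall>k x. cmod (trig (\<lambda>m. q m * mi_diff_op \<alpha> (\<lambda>l. newton_rem N (\<lambda>l'. b l' m) l m) k) x)
      \<le> C * weight k powr (\<mu> - real N * (\<rho> - \<delta>) - \<rho> * real (mi_size \<alpha>) + \<delta> * real d)"
    using trig_newton_rem_bound[OF \<rho>\<delta> coeff_class_multiplier[OF b q, of \<alpha>], of N]
    unfolding eq by (simp add: algebra_simps)
qed


subsection \<open>The adjoint\<close>

lemma fourier_eq_trig: "fourier f = trig (\<lambda>m. f (- m))"
proof
  show "fourier f x = trig (\<lambda>m. f (- m)) x" for x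
    unfolding fourier_def trig_def
    by (rule infsum_reindex_bij_witness[of _ uminus uminus]) (auto simp: mult.commute)
qed

lemma rapidly_decreasing_uminus:
  "f \<in> rapidly_decreasing \<Longrightarrow> (\<lambda>m. f (- m)) \<in> rapidly_decreasing"
  by (auto simp: rapidly_decreasing_iff) (metis minus_minus norm_minus_cancel of_lattice_simps(3))

text \<open>The series of \<open>fourier f\<close> has coefficient f(-m) at m; integrated termwise
  against the character of k and the symbol, it picks out the coefficient of the symbol at -m - k.
  With l = -m the operator is the matrix with entries \<open>a k (l - k)\<close>.\<close>

lemma Op_trig_has_sum:
  assumes a: "a k \<in> rapidly_decreasing" and f: "f \<in> rapidly_decreasing"
  shows "((\<lambda>l. f l * a k (l - k)) has_sum Op (\<lambda>k. trig (a k)) f k) UNIV"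
proof -
  note f' = rapidly_decreasing_uminus[OF f]
  define h where "h x = character k x * trig (a k) x" for x
  have h: "continuous_on UNIV h"
    unfolding h_def by (intro continuous_intros continuous_on_trig a)
  have cont: "continuous_on (cbox 0 1) (\<lambda>x. h x * fourier f x)"
    unfolding fourier_eq_trig
    by (intro continuous_intros continuous_on_trig f' continuous_on_subset[OF h]) auto
  have "Op (\<lambda>k. trig (a k)) f k = (LINT x:cbox 0 1|lborel. h x * fourier f x)"
    by (simp add: Op_def h_def)
  also have "\<dots> = integral (cbox 0 1) (\<lambda>x. h x * fourier f x)"
    by (intro set_borel_integral_eq_integral(2) borel_integrable_compact[OF compact_cbox cont, folded set_integrable_def])
  also have "\<dots> = integral (cbox 0 1) (\<lambda>x. trig (\<lambda>m. f (- m)) x * h x)"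
    by (simp add: fourier_eq_trig mult.commute)
  finally have Op: "Op (\<lambda>k. trig (a k)) f k = integral (cbox 0 1) (\<lambda>x. trig (\<lambda>m. f (- m)) x * h x)" .
  have coeff: "integral (cbox 0 1) (\<lambda>x. character m x * h x) = a k (- m - k)" for m
  proof -
    have "integral (cbox 0 1) (\<lambda>x. character m x * h x) = fourier_coeff (trig (a k)) (- m - k)"
      unfolding fourier_coeff_def h_def
      by (rule arg_cong[where f = "integral (cbox 0 1)"])
         (simp add: fun_eq_iff character_add_left mult_ac)
    then show ?thesis by (simp add: fourier_coeff_trig[OF a])
  qed
  have "((\<lambda>m. f (- m) * a k (- m - k)) has_sum Op (\<lambda>k. trig (a k)) f k) UNIV"
    unfolding Op using integral_trig_has_sum[OF f' h] by (simp only: coeff)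
  then show ?thesis
    by (subst (asm) has_sum_reindex_bij_witness[of _ uminus uminus _ "\<lambda>l. f l * a k (l - k)"]) auto
qed

text \<open>The second symbol is read off from the conjugate transpose of the matrix of the first.
  The identity is an interchange of the sums over k and l: the polynomial growth of \<open>a\<close>
  in k is absorbed by g, and f makes the sum over l converge.\<close>

lemma is_adjoint_Op_trig:
  fixes a :: "int ^ 'n::finite \<Rightarrow> int ^ 'n \<Rightarrow> complex"
  assumes a: "\<And>k. a k \<in> rapidly_decreasing" and a': "\<And>k. (\<lambda>m. cnj (a (k + m) (- m))) \<in> rapidly_decreasing"
    and bound: "\<And>k m. cmod (a k m) \<le> C * weight k ^ p"
  shows "is_adjoint (Op (\<lambda>k. trig (a k))) (Op (\<lambda>k. trig (\<lambda>m. cnj (a (k + m) (- m)))))"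
  unfolding is_adjoint_def
proof (intro ballI)
  fix f g :: "int ^ 'n \<Rightarrow> complex" assume f: "f \<in> rapidly_decreasing" and g: "g \<in> rapidly_decreasing"
  define T where "T = Op (\<lambda>k. trig (a k))"
  define T' where "T' = Op (\<lambda>k. trig (\<lambda>m. cnj (a (k + m) (- m))))"
  define G where "G k l = f l * a k (l - k) * cnj (g k)" for k l
  have row: "((\<lambda>l. G k l) has_sum T f k * cnj (g k)) UNIV" for k
    unfolding G_def T_def by (intro has_sum_cmult_left Op_trig_has_sum a f)
  have col: "((\<lambda>k. G k l) has_sum f l * cnj (T' g l)) UNIV" for l
  proof -
    \<comment> \<open>The form l + (k - l) is the one that \<open>Op_trig_has_sum\<close> produces;
      it collapses to k, which recovers the entry \<open>G k l\<close>.\<close>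
    have "((\<lambda>k. f l * cnj (g k * cnj (a (l + (k - l)) (- (k - l))))) has_sum f l * cnj (T' g l)) UNIV"
      unfolding T'_def
      by (intro has_sum_cmult_right has_sum_cnj_iff[THEN iffD2] Op_trig_has_sum[OF a' g])
    then show ?thesis by (simp add: G_def mult_ac)
  qed
  have C0: "0 \<le> C" using order.trans[OF norm_ge_zero bound[of 0 0]] by simp
  have norm_w: "cmod (of_real (C * weight k ^ p)) = C * weight k ^ p" for k :: "int ^ 'n"
    unfolding norm_of_real using C0 by simp
  have g': "(\<lambda>k. of_real (C * weight k ^ p) * g k) \<in> rapidly_decreasing"
    by (intro rapidly_decreasing_poly_bound[OF g, of _ C p]) (simp only: norm_w order_refl)
  have "(\<lambda>(k, l). cmod (of_real (C * weight k ^ p) * g k) * cmod (f l)) summable_on UNIV \<times> UNIV"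
  proof (rule summable_on_SigmaI, unfold prod.case)
    show "((\<lambda>l. cmod (of_real (C * weight k ^ p) * g k) * cmod (f l)) has_sum
        cmod (of_real (C * weight k ^ p) * g k) * (\<Sum>\<^sub>\<infinity>l. cmod (f l))) UNIV" for k
      by (intro has_sum_cmult_right has_sum_infsum rapidly_decreasing_abs_summable f)
    show "(\<lambda>k. cmod (of_real (C * weight k ^ p) * g k) * (\<Sum>\<^sub>\<infinity>l. cmod (f l))) summable_on UNIV"
      by (intro summable_on_cmult_left rapidly_decreasing_abs_summable g')
  qed auto
  then have "(\<lambda>(k, l). norm (G k l)) summable_on UNIV \<times> UNIV"
  proof (rule summable_on_comparison_test)
    fix kl :: "(int ^ 'n) \<times> (int ^ 'n)"
    obtain k l where kl: "kl = (k, l)" by fastforce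
    have "cmod (G k l) \<le> cmod (f l) * (C * weight k ^ p) * cmod (g k)"
      unfolding G_def norm_mult complex_mod_cnj by (intro mult_mono bound) (use C0 in auto)
    then show "(case kl of (k, l) \<Rightarrow> norm (G k l)) \<le>
        (case kl of (k, l) \<Rightarrow> cmod (of_real (C * weight k ^ p) * g k) * cmod (f l))"
      unfolding kl prod.case norm_mult[of _ "g k"] norm_w by (simp only: mult_ac)
  qed auto
  then have G: "(\<lambda>(k, l). G k l) summable_on UNIV \<times> UNIV"
    by (subst abs_summable_summable) (simp_all add: case_prod_unfold)
  have G': "(\<lambda>(l, k). G k l) summable_on UNIV \<times> UNIV"
    using G by (subst summable_on_swap) (simp add: case_prod_unfold)
  have rows: "(\<Sum>\<^sub>\<infinity>l. G k l) = T f k * cnj (g k)" for k by (rule infsumI[OF row])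
  have cols: "(\<Sum>\<^sub>\<infinity>k. G k l) = f l * cnj (T' g l)" for l by (rule infsumI[OF col])
  have "(\<lambda>k. T f k * cnj (g k)) summable_on UNIV"
    using summable_on_Sigma_banach[OF G] by (simp add: rows)
  moreover have "(\<lambda>l. f l * cnj (T' g l)) summable_on UNIV"
    using summable_on_Sigma_banach[OF G'] by (simp add: cols)
  moreover have "ell2_inner (T f) g = ell2_inner f (T' g)"
    using infsum_swap_banach[OF G] by (simp add: ell2_inner_def rows cols)
  ultimately show "(\<lambda>k. T f k * cnj (g k)) summable_on UNIV \<and>
      (\<lambda>k. f k * cnj (T' g k)) summable_on UNIV \<and> ell2_inner (T f) g = ell2_inner f (T' g)"
    by blast
qed

theorem theorem3p2:
  fixes \<sigma> :: "int ^ 'n::{finite,linorder} \<Rightarrow> real ^ 'n::{finite,linorder} \<Rightarrow> complex"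
    and \<mu> \<rho> \<delta> :: real
  assumes "0 \<le> \<delta>" and "\<delta> < \<rho>" and "\<rho> \<le> 1"
    and "\<sigma> \<in> symbol_class \<mu> \<rho> \<delta>"
  shows "\<exists>\<sigma>'\<in>symbol_class \<mu> \<rho> \<delta>.
    is_adjoint (Op \<sigma>) (Op \<sigma>') \<and>
    (\<forall>N::nat.
      (\<lambda>k x. \<sigma>' k x -
        (\<Sum>\<alpha> | mi_size \<alpha> < N.
           1 / of_nat (mi_fact \<alpha>) *
           mi_diff_op \<alpha> (\<lambda>l. mi_fall_deriv \<alpha> (\<lambda>y. cnj (\<sigma> l y)) x) k))
      \<in> symbol_class (\<mu> - real N * (\<rho> - \<delta>)) \<rho> \<delta>)"
proof -
  define a where "a k = fourier_coeff (\<sigma> k)" for k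
  define b where "b k m = cnj (a k (- m))" for k m
  define \<sigma>' where "\<sigma>' k = trig (\<lambda>m. b (k + m) m)" for k
  have "smooth_on_torus (\<sigma> k)" for k
    using assms(4) by (simp add: symbol_class_def)
  then have "\<sigma> k = trig (a k)" for k
    unfolding a_def by (rule fourier_inversion[symmetric])
  then have \<sigma>_eq: "\<sigma> = (\<lambda>k. trig (a k))" by blast
  have a: "a \<in> coeff_class \<mu> \<rho> \<delta>"
    using coeff_class_of_symbol[OF assms(4,1)] by (simp add: a_def[abs_def])
  have b: "b \<in> coeff_class \<mu> \<rho> \<delta>"
    using coeff_class_cnj_uminus[OF a] by (simp add: b_def[abs_def])
  note rd = coeff_class_rapidly_decreasing[OF b]
  have \<delta>1: "\<delta> < 1" using assms by simp
  note shift_rd = coeff_class_shift_rapidly_decreasing[OF b assms(1) \<delta>1]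
  have rem: "\<sigma>' k x - (\<Sum>\<alpha> | mi_size \<alpha> < N. 1 / of_nat (mi_fact \<alpha>) *
           mi_diff_op \<alpha> (\<lambda>l. mi_fall_deriv \<alpha> (\<lambda>y. cnj (\<sigma> l y)) x) k) =
       trig (\<lambda>m. newton_rem N (\<lambda>l. b l m) k m) x" for N k x
  proof -
    have "(\<lambda>y. cnj (\<sigma> l y)) = trig (b l)" for l
      by (simp add: \<sigma>_eq trig_cnj b_def[abs_def])
    \<comment> \<open>The multiplier of the derivative does not depend on k, so the difference
      passes it and the term of the expansion becomes a Newton term of b.\<close>
    then have "mi_diff_op \<alpha> (\<lambda>l. mi_fall_deriv \<alpha> (\<lambda>y. cnj (\<sigma> l y)) x) k =
        trig (\<lambda>m. falling \<alpha> m * mi_diff_op \<alpha> (\<lambda>l. b l m) k) x" for \<alpha>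
      using mi_diff_op_trig(2)[of "\<lambda>l m. falling \<alpha> m * b l m" \<alpha> x k]
      by (simp add: mi_fall_deriv_trig(2)[OF rd] rapidly_decreasing_falling[OF rd] mi_diff_op_cmult)
    moreover have "(\<lambda>m. falling \<alpha> m * mi_diff_op \<alpha> (\<lambda>l. b l m) k) \<in> rapidly_decreasing" for \<alpha>
      by (intro rapidly_decreasing_falling rapidly_decreasing_mi_diff_op rd)
    ultimately show ?thesis
      unfolding \<sigma>'_def newton_rem_def
      by (subst trig_diff[OF shift_rd])
         (auto intro!: rapidly_decreasing_sum rapidly_decreasing_cmult sum.cong
           simp: trig_sum rapidly_decreasing_cmult trig_cmult simp del: times_divide_eq_left)
  qed
  have asymp: "(\<lambda>k. trig (\<lambda>m. newton_rem N (\<lambda>l. b l m) k m)) \<in> symbol_class (\<mu> - real N * (\<rho> - \<delta>)) \<rho> \<delta>" for N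
    by (intro symbol_of_coeff_class newton_rem_coeff_class assms b)
  \<comment> \<open>For N = 0 nothing is subtracted and the order is \<mu>, so membership of
    \<open>\<sigma>'\<close> is a special case of the expansion.\<close>
  have "\<sigma>' \<in> symbol_class \<mu> \<rho> \<delta>"
    using asymp[of 0] by (simp add: \<sigma>'_def[abs_def])
  moreover have "is_adjoint (Op \<sigma>) (Op \<sigma>')"
  proof -
    obtain C where C: "C > 0" "\<And>k m. weight m ^ 0 * cmod (a k m) \<le> C * weight k powr (\<mu> + \<delta> * real 0)"
      using coeff_class_decay_0[OF a, of 0] by blast
    \<comment> \<open>\<open>nat\<close> sends the rounded exponent to 0 when \<mu> is negative; a
      polynomial bound is all that the interchange of sums asks for.\<close>
    have "cmod (a k m) \<le> C * weight k ^ nat \<lceil>\<mu>\<rceil>" for k m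
    proof -
      have "cmod (a k m) \<le> C * weight k powr \<mu>" using C(2)[of m k] by simp
      also have "\<dots> \<le> C * weight k powr real (nat \<lceil>\<mu>\<rceil>)"
        using C(1) by (intro mult_left_mono powr_mono) (auto, linarith)
      finally show ?thesis by (simp add: powr_realpow)
    qed
    moreover have "(\<lambda>m. cnj (a (k + m) (- m))) \<in> rapidly_decreasing" for k
      using shift_rd[of k] by (simp add: b_def)
    ultimately have "is_adjoint (Op (\<lambda>k. trig (a k))) (Op (\<lambda>k. trig (\<lambda>m. cnj (a (k + m) (- m)))))"
      by (intro is_adjoint_Op_trig coeff_class_rapidly_decreasing[OF a])
    then show ?thesis by (simp add: \<sigma>_eq \<sigma>'_def[abs_def] b_def)
  qed
  ultimately show ?thesis
    using asymp by (intro bexI[of _ \<sigma>'] conjI allI) (simp_all only: rem)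
qed

end
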